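(* Let $f$ be an entire function which is not a polynomial of degree $0$ or $1$, let $z_0\in\mathbb{C}$ be an attracting fixed point of $f$ with multiplier $\lambda=f'(z_0)$, $0<|\lambda|<1$, and let $A(z_0)$, $O^-(z_0)$, $\Phi$ and $G_0$ be as defined in the context. Then $G_0$ is an open dense subset of $A(z_0)\setminus O^-(z_0)$ such that $\dim_H\big(A(z_0)\setminus G_0\big)=1$ and $$\omega(G_0,g,f)=H_\Phi(G_0)$$ for each locally universal function $g$ for $C_f$.
   Context: $\mathbb{N}=\{1,2,\dots\}$, $\mathbb{N}_0=\mathbb{N}\cup\{0\}$; $f^n$ is the $n$-th iterate of $f$; $f^{-n}(W)$ is the preimage of $W$ under $f^n$. For open $W\subset\mathbb{C}$, $H(W)$ is the space of holomorphic functions on $W$ with the topology of locally uniform convergence. A conformal map is a bijective holomorphic map. $\dim_H$ is Hausdorff dimension. $U_\delta(0)=\{w\in\mathbb{C}:|w|<\delta\}$. A set $M\subset\mathbb{C}$ has no holes if every component of $\mathbb{C}_\infty\setminus M$ contains $\infty$, where $\mathbb{C}_\infty=\mathbb{C}\cup\{\infty\}$; $\mathcal{U}_0(M)$ is the set of non-empty subsets of $M$ which are open in $\mathbb{C}$ and have no holes. $A(z_0):=\{z\in\mathbb{C}:f^n(z)\to z_0\}$ is the basin of attraction and $O^-(z_0):=\bigcup_{n\in\mathbb{N}}\{z:f^n(z)=z_0\}$ the backward orbit of $z_0$. By Koenigs' theorem there are open neighbourhoods $U$ of $z_0$ and $V$ of $0$ with $f(U)\subset U$, $\lambda V\subset V$,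 and a conformal map $\varphi:U\to V$ with $\varphi\circ f^n=\lambda^n\varphi$ on $U$ for all $n\in\mathbb{N}$; fix such a choice with $V=U_\delta(0)$ for some $\delta>0$. The map $\varphi$ extends to a holomorphic function $\Phi:A(z_0)\to\mathbb{C}$ with $\Phi|_U=\varphi$ and $\Phi\circ f^n=\lambda^n\Phi$ on $A(z_0)$ for all $n\in\mathbb{N}$. Definition of $G_0$: fix a logarithm of $\lambda$ (defining $\lambda^t$ for real $t$), let $S_0:=\{\delta\lambda^t:t\in(0,\infty)\}\cup\{0\}$, $V_0:=V\setminus S_0$, $U_0:=\varphi^{-1}(V_0)$ and $G_0:=\bigcup_{n\in\mathbb{N}_0}f^{-n}(U_0)$. For $G\subset A(z_0)$ open, $H_\Phi(G):=\{\psi\circ\Phi|_G:\psi\in H(\Phi(G))\}$ (this does not depend on the choice of $U,V,\varphi$). For $G\subset A(z_0)\setminus O^-(z_0)$ open and $g\in H(A(z_0)\setminus\{z_0\})$, $\omega(G,g,f)$ is the set of all functions $h:G\to\mathbb{C}$ for which there is a strictly increasing sequence $(n_k)$ in $\mathbb{N}$ such that $g\circ f^{n_k}\to h$ locally uniformly on $G$. A function $g\in H(A(z_0)\setminus\{z_0\})$ is called locally universal for $C_f$ if there exist open neighbourhoods $U'$ of $z_0$ and $V'$ of $0$ with $f(U')\subset U'$ and a conformal map $\varphi':U'\to V'$ with $\varphi'\circ f=\lambda\varphi'$ on $U'$ such that $\{g\circ f^n|_W:n\in\mathbb{N}\}$ is dense in $H(W)$ for all $W\in\mathcal{U}_0(U'\setminus\{z_0\})$.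 *)

theory Defs
  imports "HOL-Complex_Analysis.Complex_Analysis"
begin

section \<open>Hausdorff dimension\<close>

text \<open>The contribution \<open>diam(E)\<^sup>s\<close> of a set to the \<open>s\<close>-dimensional Hausdorff measure,
  with \<open>diam(E)\<^sup>0 = 1\<close> for nonempty \<open>E\<close>; note that in HOL \<open>0 powr 0 = 0\<close>.\<close>

definition diam_powr :: "real \<Rightarrow> 'a::metric_space set \<Rightarrow> ennreal" where
  "diam_powr s E =
     (if E = {} then 0 else if s = 0 then 1 else ennreal (diameter E powr s))"

text \<open>Boundedness of the covering sets is required explicitly because \<^const>\<open>diameter\<close> is
  unspecified on unbounded sets.\<close>

definition hausdorff_premeasure :: "real \<Rightarrow> real \<Rightarrow> 'a::metric_space set \<Rightarrow> ennreal" where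
  "hausdorff_premeasure s d A =
     (INF E \<in> {E :: nat \<Rightarrow> 'a set. A \<subseteq> (\<Union>i. E i) \<and> (\<forall>i. bounded (E i) \<and> diameter (E i) \<le> d)}.
        \<Sum>i. diam_powr s (E i))"

definition hausdorff_measure :: "real \<Rightarrow> 'a::metric_space set \<Rightarrow> ennreal" where
  "hausdorff_measure s A = (SUP d \<in> {0<..}. hausdorff_premeasure s d A)"

definition hausdorff_dim :: "'a::metric_space set \<Rightarrow> ennreal" where
  "hausdorff_dim A = Inf {ennreal s | s. 0 \<le> s \<and> hausdorff_measure s A = 0}"


section \<open>Spaces of holomorphic functions\<close>

text \<open>Functions \<open>W \<rightarrow> \<complex>\<close> are represented by total functions that are \<^const>\<open>undefined\<close>
  outside \<open>W\<close>, so that equality in \<open>H(W)\<close> is equality on \<open>W\<close>.\<close>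

definition hol :: "complex set \<Rightarrow> (complex \<Rightarrow> complex) set" where
  "hol W = {h \<in> extensional W. h holomorphic_on W}"

text \<open>For open \<open>W\<close>, locally uniform convergence on \<open>W\<close> is uniform convergence on the compact
  subsets of \<open>W\<close>.\<close>

definition hol_nbhd :: "complex set \<Rightarrow> (complex \<Rightarrow> complex) \<Rightarrow> complex set \<Rightarrow> real
    \<Rightarrow> (complex \<Rightarrow> complex) set" where
  "hol_nbhd W h K e = {k \<in> hol W. \<forall>z\<in>K. dist (k z) (h z) < e}"

definition hol_open :: "complex set \<Rightarrow> (complex \<Rightarrow> complex) set \<Rightarrow> bool" where
  "hol_open W X \<longleftrightarrow> X \<subseteq> hol W \<and>
     (\<forall>h\<in>X. \<exists>K e. compact K \<and> K \<subseteq> W \<and> 0 < e \<and> hol_nbhd W h K e \<subseteq> X)"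

definition hol_topology :: "complex set \<Rightarrow> (complex \<Rightarrow> complex) topology" where
  "hol_topology W = topology (hol_open W)"

lemma hol_open_subset: "hol_open W X \<Longrightarrow> X \<subseteq> hol W"
  by (simp add: hol_open_def)

lemma hol_open_nbhd:
  assumes "hol_open W X" "h \<in> X"
  obtains K e where "compact K" "K \<subseteq> W" "0 < e" "hol_nbhd W h K e \<subseteq> X"
  using assms unfolding hol_open_def by meson

lemma hol_openI:
  assumes "X \<subseteq> hol W"
    and "\<And>h. h \<in> X \<Longrightarrow> \<exists>K e. compact K \<and> K \<subseteq> W \<and> 0 < e \<and> hol_nbhd W h K e \<subseteq> X"
  shows "hol_open W X"
  using assms unfolding hol_open_def by simp

lemma istopology_hol_open: "istopology (hol_open W)"
  unfolding istopology_def
proof (intro conjI allI impI)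
  fix S T
  assume S: "hol_open W S" and T: "hol_open W T"
  show "hol_open W (S \<inter> T)"
  proof (rule hol_openI)
    show "S \<inter> T \<subseteq> hol W"
      using hol_open_subset[OF S] by blast
  next
    fix h assume h: "h \<in> S \<inter> T"
    obtain K1 e1 where 1: "compact K1" "K1 \<subseteq> W" "0 < e1" "hol_nbhd W h K1 e1 \<subseteq> S"
      using h by (meson IntD1 S hol_open_nbhd)
    obtain K2 e2 where 2: "compact K2" "K2 \<subseteq> W" "0 < e2" "hol_nbhd W h K2 e2 \<subseteq> T"
      using h by (meson IntD2 T hol_open_nbhd)
    have "hol_nbhd W h (K1 \<union> K2) (min e1 e2) \<subseteq> S \<inter> T"
      using 1(4) 2(4) by (auto simp: hol_nbhd_def)
    moreover have "compact (K1 \<union> K2)" "K1 \<union> K2 \<subseteq> W" "0 < min e1 e2"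
      using 1 2 by auto
    ultimately show "\<exists>K e. compact K \<and> K \<subseteq> W \<and> 0 < e \<and> hol_nbhd W h K e \<subseteq> S \<inter> T"
      by blast
  qed
next
  fix \<K> assume K: "\<forall>X\<in>\<K>. hol_open W X"
  show "hol_open W (\<Union>\<K>)"
  proof (rule hol_openI)
    show "\<Union>\<K> \<subseteq> hol W"
      using K hol_open_subset by blast
  next
    fix h assume "h \<in> \<Union>\<K>"
    then obtain X where X: "X \<in> \<K>" "h \<in> X" by blast
    then obtain K e where "compact K" "K \<subseteq> W" "0 < e" "hol_nbhd W h K e \<subseteq> X"
      using K by (meson hol_open_nbhd)
    moreover from this X have "hol_nbhd W h K e \<subseteq> \<Union>\<K>" by blast
    ultimately show "\<exists>K e. compact K \<and> K \<subseteq> W \<and> 0 < e \<and> hol_nbhd W h K e \<subseteq> \<Union>\<K>"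
      by blast
  qed
qed

lemma openin_hol_topology: "openin (hol_topology W) X \<longleftrightarrow> hol_open W X"
  by (simp add: hol_topology_def istopology_hol_open)

lemma topspace_hol_topology [simp]: "topspace (hol_topology W) = hol W"
proof (rule antisym)
  show "topspace (hol_topology W) \<subseteq> hol W"
    unfolding topspace_def openin_hol_topology using hol_open_subset by blast
  have "hol_nbhd W h {} 1 \<subseteq> hol W" for h
    by (auto simp: hol_nbhd_def)
  then have "hol_open W (hol W)"
    by (intro hol_openI exI[of _ "{}"] exI[of _ 1]) simp_all
  then show "hol W \<subseteq> topspace (hol_topology W)"
    by (metis openin_hol_topology openin_subset)
qed

definition dense_in_hol :: "complex set \<Rightarrow> (complex \<Rightarrow> complex) set \<Rightarrow> bool" where
  "dense_in_hol W D \<longleftrightarrow> D \<subseteq> hol W \<and> hol_topology W closure_of D = hol W"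

lemma dense_in_hol_iff:
  "dense_in_hol W D \<longleftrightarrow> D \<subseteq> hol W \<and>
     (\<forall>h\<in>hol W. \<forall>K e. compact K \<and> K \<subseteq> W \<and> 0 < e \<longrightarrow> (\<exists>k\<in>D. \<forall>z\<in>K. dist (k z) (h z) < e))"
proof -
  have nb: "\<exists>X. hol_open W X \<and> h \<in> X \<and> X \<subseteq> hol_nbhd W h K e"
    if h: "h \<in> hol W" and K: "compact K" "K \<subseteq> W" and e: "0 < e" for h K e
  proof -
    let ?X = "{k \<in> hol W. \<exists>d<e. \<forall>z\<in>K. dist (k z) (h z) \<le> d}"
    have "hol_open W ?X"
    proof (rule hol_openI)
      show "?X \<subseteq> hol W" by auto
    next
      fix k assume "k \<in> ?X"
      then obtain d where d: "d < e" "\<forall>z\<in>K. dist (k z) (h z) \<le> d" by auto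
      have "hol_nbhd W k K ((e - d) / 2) \<subseteq> ?X"
      proof
        fix j assume j: "j \<in> hol_nbhd W k K ((e - d) / 2)"
        have "dist (j z) (h z) \<le> (e + d) / 2" if "z \<in> K" for z
        proof -
          have "dist (j z) (h z) \<le> dist (j z) (k z) + dist (k z) (h z)"
            by (rule dist_triangle)
          moreover have "dist (j z) (k z) < (e - d) / 2"
            using j that by (auto simp: hol_nbhd_def)
          moreover have "dist (k z) (h z) \<le> d"
            using d that by auto
          ultimately show ?thesis by argo
        qed
        moreover have "(e + d) / 2 < e" using d by simp
        ultimately have "\<exists>d<e. \<forall>z\<in>K. dist (j z) (h z) \<le> d" by blast
        then show "j \<in> ?X"
          using j by (simp add: hol_nbhd_def)
      qed
      then show "\<exists>K e. compact K \<and> K \<subseteq> W \<and> 0 < e \<and> hol_nbhd W k K e \<subseteq> ?X"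
        using K d by (intro exI[of _ K] exI[of _ "(e - d) / 2"]) auto
    qed
    moreover have "\<exists>d<e. \<forall>z\<in>K. dist (h z) (h z) \<le> d"
      using e by (intro exI[of _ 0]) simp
    then have "h \<in> ?X"
      using h by simp
    moreover have "?X \<subseteq> hol_nbhd W h K e"
      unfolding hol_nbhd_def by (clarsimp, meson order_le_less_trans)
    ultimately show ?thesis by blast
  qed
  have cl: "h \<in> hol_topology W closure_of D \<longleftrightarrow>
      (\<forall>K e. compact K \<and> K \<subseteq> W \<and> 0 < e \<longrightarrow> (\<exists>k\<in>D. \<forall>z\<in>K. dist (k z) (h z) < e))"
    if D: "D \<subseteq> hol W" and h: "h \<in> hol W" for h
  proof
    assume *: "h \<in> hol_topology W closure_of D"
    show "\<forall>K e. compact K \<and> K \<subseteq> W \<and> 0 < e \<longrightarrow> (\<exists>k\<in>D. \<forall>z\<in>K. dist (k z) (h z) < e)"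
    proof (intro allI impI)
      fix K and e :: real assume K: "compact K \<and> K \<subseteq> W \<and> 0 < e"
      obtain X where X: "hol_open W X" "h \<in> X" "X \<subseteq> hol_nbhd W h K e"
        using nb[OF h, of K e] K by meson
      then obtain k where k: "k \<in> D" "k \<in> X"
        using * unfolding in_closure_of openin_hol_topology by meson
      then have "k \<in> hol_nbhd W h K e" using X by blast
      with k show "\<exists>k\<in>D. \<forall>z\<in>K. dist (k z) (h z) < e"
        unfolding hol_nbhd_def by blast
    qed
  next
    assume *: "\<forall>K e. compact K \<and> K \<subseteq> W \<and> 0 < e \<longrightarrow> (\<exists>k\<in>D. \<forall>z\<in>K. dist (k z) (h z) < e)"
    have "\<exists>k. k \<in> D \<and> k \<in> X" if X: "h \<in> X" "hol_open W X" for X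
    proof -
      obtain K e where K: "compact K" "K \<subseteq> W" "0 < e" and sub: "hol_nbhd W h K e \<subseteq> X"
        using X by (meson hol_open_nbhd)
      obtain k where k: "k \<in> D" "\<forall>z\<in>K. dist (k z) (h z) < e"
        using * K by meson
      then have "k \<in> hol_nbhd W h K e"
        unfolding hol_nbhd_def using D by blast
      with k sub show ?thesis by blast
    qed
    then show "h \<in> hol_topology W closure_of D"
      using h unfolding in_closure_of openin_hol_topology by simp
  qed
  show ?thesis
  proof (cases "D \<subseteq> hol W")
    case True
    have "hol_topology W closure_of D \<subseteq> hol W"
      using closure_of_subset_topspace[of "hol_topology W" D] by simp
    then have "hol_topology W closure_of D = hol W \<longleftrightarrow>
        (\<forall>h\<in>hol W. h \<in> hol_topology W closure_of D)"
      by blast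
    also have "\<dots> \<longleftrightarrow> (\<forall>h\<in>hol W. \<forall>K e. compact K \<and> K \<subseteq> W \<and> 0 < e \<longrightarrow>
        (\<exists>k\<in>D. \<forall>z\<in>K. dist (k z) (h z) < e))"
      by (rule ball_cong[OF refl cl[OF True]])
    finally show ?thesis
      using True by (simp only: dense_in_hol_def)
  qed (simp add: dense_in_hol_def)
qed

definition loc_uniform_limit ::
    "complex set \<Rightarrow> (nat \<Rightarrow> complex \<Rightarrow> complex) \<Rightarrow> (complex \<Rightarrow> complex) \<Rightarrow> bool" where
  "loc_uniform_limit G F h \<longleftrightarrow>
     (\<forall>z\<in>G. \<exists>N. open N \<and> z \<in> N \<and> uniform_limit (N \<inter> G) F h sequentially)"

definition conformal_map :: "(complex \<Rightarrow> complex) \<Rightarrow> complex set \<Rightarrow> complex set \<Rightarrow> bool" where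
  "conformal_map \<phi> U V \<longleftrightarrow> \<phi> holomorphic_on U \<and> bij_betw \<phi> U V"


section \<open>Open sets without holes\<close>

text \<open>\<open>\<complex>\<^sub>\<infinity>\<close> is the one-point compactification of \<open>\<complex>\<close>, where \<open>None\<close> plays the role of \<open>\<infinity>\<close>.\<close>

definition riemann_sphere :: "complex option topology" where
  "riemann_sphere = Alexandroff_compactification euclidean"

definition no_holes :: "complex set \<Rightarrow> bool" where
  "no_holes M \<longleftrightarrow>
     (\<forall>C \<in> connected_components_of (subtopology riemann_sphere (topspace riemann_sphere - Some ` M)).
        None \<in> C)"

definition U0_sets :: "complex set \<Rightarrow> complex set set" where
  "U0_sets M = {W. W \<noteq> {} \<and> W \<subseteq> M \<and> open W \<and> no_holes W}"


section \<open>Dynamics near an attracting fixed point\<close>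

definition attraction_basin :: "(complex \<Rightarrow> complex) \<Rightarrow> complex \<Rightarrow> complex set" where
  "attraction_basin f z0 = {z. (\<lambda>n. (f ^^ n) z) \<longlonglongrightarrow> z0}"

definition backward_orbit :: "(complex \<Rightarrow> complex) \<Rightarrow> complex \<Rightarrow> complex set" where
  "backward_orbit f z0 = (\<Union>n\<in>{1..}. {z. (f ^^ n) z = z0})"

text \<open>\<open>G\<^sub>0\<close> for the Koenigs chart \<open>\<phi> : U \<rightarrow> U\<^sub>\<delta>(0)\<close>; \<open>l\<close> is the chosen logarithm of the multiplier
  \<open>\<lambda>\<close>, so that \<open>\<lambda>\<^sup>t = exp (t l)\<close>.\<close>

definition S0_set :: "real \<Rightarrow> complex \<Rightarrow> complex set" where
  "S0_set \<delta> l = {of_real \<delta> * exp (of_real t * l) | t. 0 < t} \<union> {0}"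

definition U0_set :: "complex set \<Rightarrow> (complex \<Rightarrow> complex) \<Rightarrow> real \<Rightarrow> complex \<Rightarrow> complex set" where
  "U0_set U \<phi> \<delta> l = {z \<in> U. \<phi> z \<in> ball 0 \<delta> - S0_set \<delta> l}"

definition G0_set :: "(complex \<Rightarrow> complex) \<Rightarrow> complex set \<Rightarrow> (complex \<Rightarrow> complex) \<Rightarrow> real
    \<Rightarrow> complex \<Rightarrow> complex set" where
  "G0_set f U \<phi> \<delta> l = (\<Union>n. (f ^^ n) -` U0_set U \<phi> \<delta> l)"

definition H_Phi :: "(complex \<Rightarrow> complex) \<Rightarrow> complex set \<Rightarrow> (complex \<Rightarrow> complex) set" where
  "H_Phi \<Phi> G = {restrict (\<psi> \<circ> \<Phi>) G | \<psi>. \<psi> \<in> hol (\<Phi> ` G)}"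

definition omega_limit :: "complex set \<Rightarrow> (complex \<Rightarrow> complex) \<Rightarrow> (complex \<Rightarrow> complex)
    \<Rightarrow> (complex \<Rightarrow> complex) set" where
  "omega_limit G g f =
     {h \<in> extensional G. \<exists>r :: nat \<Rightarrow> nat. strict_mono r \<and> (\<forall>k. 1 \<le> r k) \<and>
        loc_uniform_limit G (\<lambda>k. g \<circ> (f ^^ r k)) h}"

definition locally_universal :: "(complex \<Rightarrow> complex) \<Rightarrow> complex \<Rightarrow> complex
    \<Rightarrow> (complex \<Rightarrow> complex) \<Rightarrow> bool" where
  "locally_universal f z0 lam g \<longleftrightarrow>
     g holomorphic_on (attraction_basin f z0 - {z0}) \<and>
     (\<exists>U V \<phi>. open U \<and> z0 \<in> U \<and> open V \<and> 0 \<in> V \<and> f ` U \<subseteq> U \<and> conformal_map \<phi> U V \<and>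
        (\<forall>z\<in>U. \<phi> (f z) = lam * \<phi> z) \<and>
        (\<forall>W\<in>U0_sets (U - {z0}). dense_in_hol W {restrict (g \<circ> (f ^^ n)) W | n. 1 \<le> n}))"

end

theory Submission
  imports Defs
begin

text \<open>Let \<open>T\<close> be the full logarithmic spiral \<open>{\<delta>\<lambda>\<^sup>t : t real} \<union> {0}\<close>. It is invariant under multiplication
  by \<open>\<lambda>\<close> in both directions, and inside the disc \<open>U\<^sub>\<delta>(0)\<close> it coincides with \<open>S\<^sub>0\<close>. As \<open>\<Phi>\<close> conjugates
  \<open>f\<close> to multiplication by \<open>\<lambda>\<close>, this turns \<open>G\<^sub>0\<close> into the set of all points of the basin with
  \<open>\<Phi>(z) \<notin> T\<close> (\<open>G0_eq\<close>), and its complement in the basin into the preimage \<open>\<Phi>\<^sup>-\<^sup>1(T)\<close>. The topological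
  claims follow, since \<open>T\<close> is closed with empty interior, contains \<open>0\<close>, and \<open>\<Phi>\<close> is an open map.

  For the dimension, \<open>T\<close> consists of \<open>0\<close> and countably many Lipschitz arcs and thus has \<open>s\<close>-dimensional measure
  \<open>0\<close> for each \<open>s > 1\<close>. This passes to \<open>\<Phi>\<^sup>-\<^sup>1(T)\<close> because \<open>\<Phi>\<close> has only countably many critical points and
  a Lipschitz local inverse everywhere else. Conversely, \<open>\<Phi>\<^sup>-\<^sup>1(T)\<close> contains an arc, and a connected
  set with more than one point has positive \<open>s\<close>-dimensional measure for all \<open>s \<le> 1\<close>.

  For the limit functions, let \<open>\<rho> = \<phi>\<^sup>-\<^sup>1\<close>. Once the orbit of \<open>z\<close> has entered \<open>U\<close> we have
  \<open>g(f\<^sup>k(z)) = P\<^sub>k(\<Phi>(z))\<close> with \<open>P\<^sub>k(w) = g(\<rho>(\<lambda>\<^sup>kw))\<close>. So convergence of a subsequence of \<open>g \<circ> f\<^sup>k\<close> on \<open>G\<^sub>0\<close>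
  is convergence of the holomorphic functions \<open>P\<^sub>k\<close> on \<open>\<Phi>(G\<^sub>0)\<close>, and every limit function has the form
  \<open>\<psi> \<circ> \<Phi>\<close> with holomorphic \<open>\<psi>\<close> (\<open>omega_limit_subset_H_Phi\<close>).

  That every such \<open>\<psi>\<close> occurs requires approximating it by functions \<open>P\<^sub>k\<close> on compact subsets of
  \<open>\<Phi>(G\<^sub>0)\<close>. Universality provides this on sets without holes. A disc minus the spiral is the
  injective image of a convex set under the exponential function, hence simply connected, so its
  image under \<open>\<rho>\<close> is simply connected as well and therefore has no holes. It remains to know that
  \<open>\<psi>\<close> is defined on all of this slit disc, that is, that \<open>\<Phi>(G\<^sub>0)\<close> is the whole
  complement of \<open>T\<close> (\<open>\<Phi>_image_G0\<close>): by the great Picard theorem the iterates of \<open>f\<close> omit at most one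
  fixed exceptional value, while each \<open>w \<notin> T\<close> can be reached through either of two consecutive
  points \<open>\<rho>(\<lambda>\<^sup>nw)\<close> and \<open>\<rho>(\<lambda>\<^sup>n\<^sup>+\<^sup>1w)\<close>.\<close>

section \<open>Sets of Hausdorff measure zero and connected sets\<close>

lemma diameter_leI:
  fixes S :: "'a::metric_space set"
  assumes "0 \<le> d" and "\<And>x y. x \<in> S \<Longrightarrow> y \<in> S \<Longrightarrow> dist x y \<le> d"
  shows "diameter S \<le> d"
  using assms unfolding diameter_def by (auto intro: cSUP_least)

lemma hausdorff_null_iff:
  "hausdorff_measure s A = 0 \<longleftrightarrow>
     (\<forall>d>0. \<forall>e>0. \<exists>E :: nat \<Rightarrow> 'a::metric_space set. A \<subseteq> (\<Union>i. E i) \<and>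
        (\<forall>i. bounded (E i) \<and> diameter (E i) \<le> d) \<and> (\<Sum>i. diam_powr s (E i)) < ennreal e)"
proof -
  have pos: "x = 0 \<longleftrightarrow> (\<forall>e>0. x < ennreal e)" for x
  proof
    assume "\<forall>e>0. x < ennreal e"
    then have "x \<le> 0"
      by (intro ennreal_le_epsilon[of 0 x]) (simp add: less_imp_le)
    then show "x = 0" by simp
  qed simp
  have pre: "hausdorff_premeasure s d A = 0 \<longleftrightarrow> (\<forall>e>0. \<exists>E :: nat \<Rightarrow> 'a set. A \<subseteq> (\<Union>i. E i) \<and>
        (\<forall>i. bounded (E i) \<and> diameter (E i) \<le> d) \<and> (\<Sum>i. diam_powr s (E i)) < ennreal e)" for d
    by (simp add: pos hausdorff_premeasure_def INF_less_iff Bex_def conj_assoc)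
  have "hausdorff_measure s A = 0 \<longleftrightarrow> hausdorff_measure s A \<le> 0"
    by simp
  also have "\<dots> \<longleftrightarrow> (\<forall>d>0. hausdorff_premeasure s d A = 0)"
    unfolding hausdorff_measure_def SUP_le_iff by auto
  finally show ?thesis
    unfolding pre by blast
qed

lemma hausdorff_nullE:
  assumes "hausdorff_measure s A = 0" "0 < d" "0 < e"
  obtains E :: "nat \<Rightarrow> 'a::metric_space set" where "A \<subseteq> (\<Union>i. E i)"
    "\<And>i. bounded (E i)" "\<And>i. diameter (E i) \<le> d" "(\<Sum>i. diam_powr s (E i)) < ennreal e"
  using assms unfolding hausdorff_null_iff by meson

lemma hausdorff_null_subset:
  assumes "hausdorff_measure s B = 0" "A \<subseteq> B"
  shows "hausdorff_measure s A = 0"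
  using assms unfolding hausdorff_null_iff by (meson order_trans)

lemma hausdorff_null_UN:
  fixes A :: "nat \<Rightarrow> 'a::metric_space set"
  assumes "\<And>i. hausdorff_measure s (A i) = 0"
  shows "hausdorff_measure s (\<Union>i. A i) = 0"
  unfolding hausdorff_null_iff
proof (intro allI impI)
  fix d e :: real assume d: "0 < d" and e: "0 < e"
  \<comment> \<open>These bounds sum to \<open>e / 2\<close>, which leaves room for the strict inequality.\<close>
  define t where "t i = e / 2 * (1/2) ^ Suc i" for i :: nat
  have t: "0 < t i" for i using e by (simp add: t_def)
  have "\<exists>E :: nat \<Rightarrow> 'a set. A i \<subseteq> (\<Union>j. E j) \<and>
        (\<forall>j. bounded (E j) \<and> diameter (E j) \<le> d) \<and> (\<Sum>j. diam_powr s (E j)) < ennreal (t i)" for i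
    using assms[of i] d t[of i] unfolding hausdorff_null_iff by simp
  then obtain E where E: "\<And>i. A i \<subseteq> (\<Union>j. E i j)" "\<And>i j. bounded (E i j)"
      "\<And>i j. diameter (E i j) \<le> d" "\<And>i. (\<Sum>j. diam_powr s (E i j)) < ennreal (t i)"
    by metis
  define F where "F k = (case prod_decode k of (i, j) \<Rightarrow> E i j)" for k
  have "(\<Sum>k. diam_powr s (F k)) = (\<Sum>i. \<Sum>j. diam_powr s (E i j))"
    unfolding F_def
    using suminf_ennreal_2dimen[where f = "\<lambda>(i,j). diam_powr s (E i j)"
        and g = "\<lambda>i. \<Sum>j. diam_powr s (E i j)"]
    by (simp add: o_def case_prod_unfold)
  also have "\<dots> \<le> (\<Sum>i. ennreal (t i))"
    by (intro suminf_le summableI) (simp add: E(4) less_imp_le)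
  also have "\<dots> = ennreal (e / 2)"
    using sums_mult[OF power_half_series, of "e / 2"] t
    by (intro suminf_ennreal_eq) (auto simp: t_def intro: less_imp_le)
  finally have "(\<Sum>k. diam_powr s (F k)) < ennreal e"
    using e by (simp add: ennreal_less_iff order_le_less_trans)
  moreover have "(\<Union>i. A i) \<subseteq> (\<Union>k. F k)"
  proof
    fix x assume "x \<in> (\<Union>i. A i)"
    then obtain i j where "x \<in> E i j" using E(1) by blast
    then have "x \<in> F (prod_encode (i, j))" by (simp add: F_def)
    then show "x \<in> (\<Union>k. F k)" by blast
  qed
  moreover have "bounded (F k) \<and> diameter (F k) \<le> d" for k
    using E by (simp add: F_def case_prod_unfold)
  ultimately show "\<exists>E :: nat \<Rightarrow> 'a set. (\<Union>i. A i) \<subseteq> (\<Union>i. E i) \<and>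
        (\<forall>i. bounded (E i) \<and> diameter (E i) \<le> d) \<and> (\<Sum>i. diam_powr s (E i)) < ennreal e"
    by blast
qed

lemma hausdorff_null_countable_Union:
  fixes \<F> :: "'a::metric_space set set"
  assumes "countable \<F>" "\<And>A. A \<in> \<F> \<Longrightarrow> hausdorff_measure s A = 0"
  shows "hausdorff_measure s (\<Union>\<F>) = 0"
proof (cases "\<F> = {}")
  case True
  have "diam_powr s ({} :: 'a set) = 0" by (simp add: diam_powr_def)
  then have "\<exists>E :: nat \<Rightarrow> 'a set. {} \<subseteq> (\<Union>i. E i) \<and>
        (\<forall>i. bounded (E i) \<and> diameter (E i) \<le> d) \<and> (\<Sum>i. diam_powr s (E i)) < ennreal e"
    if "d > 0" "e > 0" for d e
    using that by (intro exI[of _ "\<lambda>_. {}"]) simp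
  then show ?thesis
    unfolding hausdorff_null_iff True by blast
next
  case False
  then have "\<Union>\<F> = (\<Union>i. from_nat_into \<F> i)"
    using range_from_nat_into[OF False assms(1)] by simp
  then show ?thesis
    using hausdorff_null_UN[of s "from_nat_into \<F>"] assms(2) from_nat_into[OF False] by simp
qed

lemma hausdorff_null_Un:
  fixes A B :: "'a::metric_space set"
  assumes "hausdorff_measure s A = 0" "hausdorff_measure s B = 0"
  shows "hausdorff_measure s (A \<union> B) = 0"
  using hausdorff_null_countable_Union[of "{A, B}" s] assms by auto

lemma hausdorff_null_countable:
  fixes A :: "'a::metric_space set"
  assumes "0 < s" "countable A"
  shows "hausdorff_measure s A = 0"
proof -
  have "hausdorff_measure s {a} = 0" for a :: 'a
    unfolding hausdorff_null_iff
  proof (intro allI impI exI[of _ "\<lambda>i. {a}"] conjI)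
    fix d e :: real assume "0 < d" "0 < e"
    then show "(\<Sum>i::nat. diam_powr s {a}) < ennreal e"
      using assms by (simp add: diam_powr_def)
  qed auto
  then have "hausdorff_measure s (\<Union>((\<lambda>a. {a}) ` A)) = 0"
    using assms by (intro hausdorff_null_countable_Union) auto
  then show ?thesis by simp
qed

text \<open>A map with Lipschitz constant \<open>L\<close> turns a cover into one whose sum is at most
  \<open>L\<^sup>s\<close> times as large.\<close>

lemma hausdorff_null_lipschitz_image:
  fixes h :: "'a::metric_space \<Rightarrow> 'b::metric_space"
  assumes s: "0 < s" and null: "hausdorff_measure s A = 0"
    and lip: "\<And>x y. x \<in> A \<Longrightarrow> y \<in> A \<Longrightarrow> dist (h x) (h y) \<le> L * dist x y"
  shows "hausdorff_measure s (h ` A) = 0"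
  unfolding hausdorff_null_iff
proof (intro allI impI)
  fix d e :: real assume d: "0 < d" and e: "0 < e"
  define M where "M = max L 1"
  have M: "0 < M" "L \<le> M" by (auto simp: M_def)
  have c: "0 < M powr s" using M by simp
  obtain E where E: "A \<subseteq> (\<Union>i. E i)" "\<And>i. bounded (E i)"
    "\<And>i. diameter (E i) \<le> d / M" "(\<Sum>i. diam_powr s (E i)) < ennreal (e / 2 / M powr s)"
    using hausdorff_nullE[OF null, of "d / M" "e / 2 / M powr s"] d e M c by auto
  define F where "F i = h ` (E i \<inter> A)" for i
  have dist_F: "dist u v \<le> M * diameter (E i)" if uv: "u \<in> F i" "v \<in> F i" for u v i
  proof -
    obtain x y where xy: "x \<in> E i \<inter> A" "y \<in> E i \<inter> A" "u = h x" "v = h y"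
      using uv by (auto simp: F_def)
    have "dist u v \<le> L * dist x y" using lip xy by auto
    also have "\<dots> \<le> M * dist x y" using M by (intro mult_right_mono) auto
    also have "\<dots> \<le> M * diameter (E i)"
      using diameter_bounded_bound[OF E(2)[of i], of x y] xy M by (intro mult_left_mono) auto
    finally show ?thesis .
  qed
  have diam: "diameter (F i) \<le> M * diameter (E i)" for i
    using M diameter_ge_0[OF E(2)] dist_F by (intro diameter_leI) auto
  have "diameter (F i) \<le> d" for i
    using diam[of i] E(3)[of i] M by (simp add: field_simps)
  moreover have bF: "bounded (F i)" for i
    unfolding bounded_two_points using dist_F by blast
  moreover have "h ` A \<subseteq> (\<Union>i. F i)" unfolding F_def using E(1) by blast
  moreover have "(\<Sum>i. diam_powr s (F i)) < ennreal e"
  proof -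
    have "diam_powr s (F i) \<le> ennreal (M powr s) * diam_powr s (E i)" for i
    proof (cases "E i \<inter> A = {}")
      case False
      have "diameter (F i) powr s \<le> (M * diameter (E i)) powr s"
        using s diam diameter_ge_0[OF bF] by (intro powr_mono2) auto
      also have "\<dots> = M powr s * diameter (E i) powr s"
        using M diameter_ge_0[OF E(2)] by (simp add: powr_mult)
      finally show ?thesis
        using False s by (auto simp: diam_powr_def F_def ennreal_mult[symmetric] intro: ennreal_leI)
    qed (simp add: F_def diam_powr_def)
    then have "(\<Sum>i. diam_powr s (F i)) \<le> (\<Sum>i. ennreal (M powr s) * diam_powr s (E i))"
      by (intro suminf_le summableI)
    also have "\<dots> = ennreal (M powr s) * (\<Sum>i. diam_powr s (E i))"
      by simp
    also have "\<dots> \<le> ennreal (M powr s) * ennreal (e / 2 / M powr s)"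
      using E(4) by (intro mult_left_mono less_imp_le) auto
    also have "\<dots> = ennreal (e / 2)"
      using c e by (simp add: ennreal_mult[symmetric])
    also have "\<dots> < ennreal e"
      using e by (auto simp: ennreal_less_iff)
    finally show ?thesis .
  qed
  ultimately show "\<exists>E :: nat \<Rightarrow> 'b set. h ` A \<subseteq> (\<Union>i. E i) \<and>
        (\<forall>i. bounded (E i) \<and> diameter (E i) \<le> d) \<and> (\<Sum>i. diam_powr s (E i)) < ennreal e"
    by blast
qed

text \<open>Dividing the interval into \<open>N\<close> equal parts gives the sum \<open>N \<cdot> N\<^sup>-\<^sup>s\<close>, which tends
  to \<open>0\<close>.\<close>

lemma hausdorff_null_unit_interval:
  fixes a s :: real
  assumes s: "1 < s"
  shows "hausdorff_measure s {a..a + 1} = 0"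
  unfolding hausdorff_null_iff
proof (intro allI impI)
  fix d e :: real assume d: "0 < d" and e: "0 < e"
  have "(\<lambda>N. real N powr (1 - s)) \<longlonglongrightarrow> 0"
    using s by (intro tendsto_neg_powr filterlim_real_sequentially) auto
  then have "\<forall>\<^sub>F N in sequentially. real N powr (1 - s) < e"
    using e by (simp add: order_tendsto_iff)
  moreover have "\<forall>\<^sub>F N in sequentially. 1 / real N < d"
    using order_tendstoD(2)[OF lim_1_over_n d] .
  moreover have "\<forall>\<^sub>F N in sequentially. 0 < N" by (rule eventually_gt_at_top)
  ultimately have "\<forall>\<^sub>F N in sequentially. real N powr (1 - s) < e \<and> 1 / real N < d \<and> 0 < N"
    by eventually_elim auto
  then obtain N :: nat where N: "real N powr (1 - s) < e" "1 / real N < d" "0 < N"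
    using eventually_happens'[OF sequentially_bot] by blast
  define E where "E i = (if i < N then {a + real i / N..a + real i / N + 1 / N} else {})" for i
  have diam: "diameter (E i) = 1 / N" if "i < N" for i
    using that N by (simp add: E_def diameter_closed_interval)
  have "{a..a + 1} \<subseteq> (\<Union>i. E i)"
  proof
    fix x assume x: "x \<in> {a..a + 1}"
    define i where "i = min (nat \<lfloor>(x - a) * N\<rfloor>) (N - 1)"
    have i: "i < N" using N by (auto simp: i_def)
    have "real (nat \<lfloor>(x - a) * N\<rfloor>) \<le> (x - a) * N"
      using x by (simp add: of_nat_floor)
    then have 1: "real i \<le> (x - a) * N" by (auto simp: i_def)
    have 2: "(x - a) * N \<le> real i + 1"
    proof (cases "nat \<lfloor>(x - a) * N\<rfloor> \<le> N - 1")
      case True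
      then have "real i = real (nat \<lfloor>(x - a) * N\<rfloor>)" by (simp add: i_def)
      moreover have "(x - a) * N < real_of_int \<lfloor>(x - a) * N\<rfloor> + 1" by linarith
      moreover have "0 \<le> \<lfloor>(x - a) * N\<rfloor>" using x by simp
      ultimately show ?thesis by (simp add: of_nat_nat)
    next
      case False
      then have "real i + 1 = N" using N by (simp add: i_def)
      moreover have "(x - a) * N \<le> 1 * real N" using x by (intro mult_right_mono) auto
      ultimately show ?thesis by simp
    qed
    have "x \<in> E i" using i 1 2 N by (simp add: E_def field_simps)
    then show "x \<in> (\<Union>i. E i)" by blast
  qed
  moreover have "bounded (E i) \<and> diameter (E i) \<le> d" for i
    using diam[of i] N d by (cases "i < N") (auto simp: E_def)
  moreover have "(\<Sum>i. diam_powr s (E i)) < ennreal e"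
  proof -
    have "diam_powr s (E i) = (if i < N then ennreal ((1 / N) powr s) else 0)" for i
    proof (cases "i < N")
      case True
      then have "E i \<noteq> {}" using N by (simp add: E_def)
      then show ?thesis using True diam s by (simp add: diam_powr_def)
    qed (simp add: diam_powr_def E_def)
    then have "(\<Sum>i. diam_powr s (E i)) = (\<Sum>i<N. ennreal ((1 / N) powr s))"
      by (subst suminf_finite[of "{..<N}"]) auto
    also have "\<dots> = ennreal (N * (1 / N) powr s)"
      by (simp add: sum_ennreal ennreal_of_nat_eq_real_of_nat ennreal_mult)
    also have "N * (1 / N) powr s = N powr (1 - s)"
      using N by (simp add: powr_diff powr_divide)
    also have "ennreal (N powr (1 - s)) < ennreal e"
      using N e by (auto simp: ennreal_less_iff)
    finally show ?thesis .
  qed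
  ultimately show "\<exists>E. {a..a + 1} \<subseteq> (\<Union>i. E i) \<and>
        (\<forall>i. bounded (E i) \<and> diameter (E i) \<le> d) \<and> (\<Sum>i. diam_powr s (E i)) < ennreal e"
    by blast
qed

text \<open>Projected to the line through two of its points, a connected set covers the segment between
  them. Projection does not increase diameters, and for sets of diameter at most \<open>1\<close> and \<open>s \<le> 1\<close>
  the length of a covering interval is at most its contribution to the \<open>s\<close>-dimensional sum.\<close>

lemma hausdorff_measure_connected_nonzero:
  fixes C :: "'a::euclidean_space set"
  assumes C: "connected C" "a \<in> C" "b \<in> C" "a \<noteq> b" and s: "0 \<le> s" "s \<le> 1"
  shows "hausdorff_measure s C \<noteq> 0"
proof
  assume null: "hausdorff_measure s C = 0"
  define u where "u = (b - a) /\<^sub>R norm (b - a)"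
  have u: "norm u = 1" using C by (simp add: u_def)
  define p where "p x = u \<bullet> x" for x
  have p_le: "\<bar>p x - p y\<bar> \<le> dist x y" for x y
    using Cauchy_Schwarz_ineq2[of u "x - y"] u by (simp add: p_def inner_diff_right dist_norm)
  have "p b - p a = u \<bullet> (b - a)" by (simp add: p_def inner_diff_right)
  also have "\<dots> = inverse (norm (b - a)) * (norm (b - a))\<^sup>2"
    unfolding u_def by (simp only: inner_scaleR_left power2_norm_eq_inner)
  also have "\<dots> = norm (b - a)"
    using C by (simp add: power2_eq_square)
  finally have "p b - p a = norm (b - a)" .
  then have ab: "p b - p a > 0" using C by simp
  obtain E where E: "C \<subseteq> (\<Union>i. E i)" "\<And>i. bounded (E i)"
    "\<And>i. diameter (E i) \<le> 1" "(\<Sum>i. diam_powr s (E i)) < ennreal (p b - p a)"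
    using hausdorff_nullE[OF null, of 1 "p b - p a"] ab by auto
  define J where "J i = (if E i = {} then {} else {Inf (p ` E i)..Sup (p ` E i)})" for i
  have bdd: "bdd_above (p ` E i)" "bdd_below (p ` E i)" for i
  proof -
    have "bounded (p ` E i)"
      unfolding p_def by (intro bounded_linear_image[OF E(2)] bounded_linear_inner_right)
    then show "bdd_above (p ` E i)" "bdd_below (p ` E i)"
      by (auto simp: bounded_imp_bdd_above bounded_imp_bdd_below)
  qed
  have "connected (p ` C)"
    unfolding p_def by (intro connected_continuous_image C continuous_intros)
  then have "{p a..p b} \<subseteq> p ` C"
    using C by (metis connected_contains_Icc imageI)
  also have "\<dots> \<subseteq> (\<Union>i. J i)"
  proof
    fix y assume "y \<in> p ` C"
    then obtain x i where x: "y = p x" "x \<in> E i" using E(1) by blast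
    then have "y \<in> J i"
      using bdd by (auto simp: J_def intro: cInf_lower cSup_upper)
    then show "y \<in> (\<Union>i. J i)" by blast
  qed
  finally have "emeasure lborel {p a..p b} \<le> emeasure lborel (\<Union>i. J i)"
    by (intro emeasure_mono) (auto simp: J_def)
  also have "\<dots> \<le> (\<Sum>i. emeasure lborel (J i))"
    by (intro emeasure_subadditive_countably) (auto simp: J_def)
  also have "\<dots> \<le> (\<Sum>i. diam_powr s (E i))"
  proof (intro suminf_le summableI)
    fix i
    show "emeasure lborel (J i) \<le> diam_powr s (E i)"
    proof (cases "E i = {}")
      case False
      then obtain x0 where x0: "x0 \<in> E i" by blast
      have d0: "0 \<le> diameter (E i)" using diameter_ge_0[OF E(2)] .
      have "Sup (p ` E i) \<le> Inf (p ` E i) + diameter (E i)"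
      proof (rule cSup_least)
        fix y assume "y \<in> p ` E i"
        then obtain x where x: "x \<in> E i" "y = p x" by blast
        have "y - diameter (E i) \<le> Inf (p ` E i)"
        proof (rule cInf_greatest)
          fix y' assume "y' \<in> p ` E i"
          then obtain x' where x': "x' \<in> E i" "y' = p x'" by blast
          then show "y - diameter (E i) \<le> y'"
            using p_le[of x x'] diameter_bounded_bound[OF E(2)[of i] x(1) x'(1)] x by linarith
        qed (use False in auto)
        then show "y \<le> Inf (p ` E i) + diameter (E i)" by linarith
      qed (use False in auto)
      moreover have "Inf (p ` E i) \<le> Sup (p ` E i)"
        using x0 bdd[of i] by (meson cInf_lower cSup_upper imageI order_trans)
      ultimately have "emeasure lborel (J i) \<le> ennreal (diameter (E i))"
        using False by (auto simp: J_def intro: ennreal_leI)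
      also have "\<dots> \<le> diam_powr s (E i)"
      proof (cases "s = 0 \<or> diameter (E i) = 0")
        case True
        then show ?thesis using False E(3)[of i] by (auto simp: diam_powr_def)
      next
        case nz: False
        have "diameter (E i) powr 1 \<le> diameter (E i) powr s"
          using nz d0 E(3)[of i] s by (intro powr_mono') auto
        then show ?thesis using nz d0 False by (auto simp: diam_powr_def intro: ennreal_leI)
      qed
      finally show ?thesis .
    qed (simp add: J_def)
  qed
  also have "\<dots> < ennreal (p b - p a)" by (rule E(4))
  finally show False using ab by simp
qed

section \<open>Logarithmic spirals\<close>

definition log_spiral :: "real \<Rightarrow> complex \<Rightarrow> complex set" where
  "log_spiral \<delta> l = insert 0 (range (\<lambda>t::real. of_real \<delta> * exp (of_real t * l)))"

text \<open>The height of a point above the line \<open>ln \<delta> + \<real>l\<close>, which the exponential function maps onto the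
  spiral without \<open>0\<close>. Logarithms of the same number differ in height by multiples of \<open>2\<pi>\<close>, so
  the strip of heights between \<open>0\<close> and \<open>2\<pi>\<close> contains exactly one logarithm of each point off
  the spiral.\<close>

definition log_height :: "real \<Rightarrow> complex \<Rightarrow> complex \<Rightarrow> real" where
  "log_height \<delta> l \<zeta> = Im \<zeta> - (Re \<zeta> - ln \<delta>) / Re l * Im l"

definition log_strip :: "real \<Rightarrow> complex \<Rightarrow> complex set" where
  "log_strip \<delta> l = {\<zeta>. 0 < log_height \<delta> l \<zeta> \<and> log_height \<delta> l \<zeta> < 2 * pi}"

lemma log_height_add_period:
  "log_height \<delta> l (\<zeta> + of_real (of_int (2 * n) * pi) * \<i>) = log_height \<delta> l \<zeta> + 2 * pi * n"
  by (simp add: log_height_def)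

lemma norm_spiral_point:
  assumes "0 < \<delta>"
  shows "norm (of_real \<delta> * exp (of_real t * l)) = \<delta> * exp (t * Re l)"
  using assms by (simp add: norm_mult)

lemma ball_minus_S0_set:
  assumes "0 < \<delta>" "Re l < 0"
  shows "ball 0 \<delta> - S0_set \<delta> l = ball 0 \<delta> - log_spiral \<delta> l"
proof -
  have "0 < t" if "norm (of_real \<delta> * exp (of_real t * l)) < \<delta>" for t
  proof -
    have "\<delta> * exp (t * Re l) < \<delta> * 1"
      using that assms by (simp add: norm_spiral_point)
    then have "t * Re l < 0"
      using assms by (subst (asm) mult_less_cancel_left_pos) auto
    then show ?thesis
      using assms by (simp add: mult_less_0_iff)
  qed
  then show ?thesis
    unfolding S0_set_def log_spiral_def by (fastforce simp: dist_norm)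
qed

lemma log_spiral_mult_exp:
  "exp l ^ n * w \<in> log_spiral \<delta> l \<longleftrightarrow> w \<in> log_spiral \<delta> l"
proof -
  have 1: "exp (of_real s * l) * w \<in> log_spiral \<delta> l" if w: "w \<in> log_spiral \<delta> l" for s w
  proof (cases "w = 0")
    case False
    then obtain t where "w = of_real \<delta> * exp (of_real t * l)"
      using w by (auto simp: log_spiral_def)
    then have "exp (of_real s * l) * w = of_real \<delta> * exp (of_real (s + t) * l)"
      by (simp add: exp_add ring_distribs)
    then show ?thesis unfolding log_spiral_def by blast
  qed (simp add: log_spiral_def)
  have e: "exp l ^ n = exp (of_real (real n) * l)"
    by (simp add: exp_of_nat_mult)
  have "w = exp (of_real (- real n) * l) * (exp (of_real (real n) * l) * w)"
    by (simp add: mult.assoc[symmetric] exp_add[symmetric])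
  then show ?thesis
    unfolding e using 1[of w "real n"] 1[of "exp (of_real (real n) * l) * w" "- real n"] by metis
qed

lemma exp_in_log_spiral_iff:
  assumes "0 < \<delta>" "Re l < 0"
  shows "exp \<zeta> \<in> log_spiral \<delta> l \<longleftrightarrow> (\<exists>n::int. log_height \<delta> l \<zeta> = 2 * pi * n)"
proof
  assume "exp \<zeta> \<in> log_spiral \<delta> l"
  then obtain t where "exp \<zeta> = of_real \<delta> * exp (of_real t * l)"
    by (auto simp: log_spiral_def)
  also have "\<dots> = exp (of_real (ln \<delta>) + of_real t * l)"
    using assms by (simp add: exp_add exp_of_real)
  finally obtain n :: int where
    n: "\<zeta> = of_real (ln \<delta>) + of_real t * l + of_real (of_int (2 * n) * pi) * \<i>"
    unfolding exp_eq by blast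
  have "log_height \<delta> l \<zeta> = 2 * pi * n"
    unfolding n log_height_add_period using assms by (simp add: log_height_def)
  then show "\<exists>n::int. log_height \<delta> l \<zeta> = 2 * pi * n" by blast
next
  assume "\<exists>n::int. log_height \<delta> l \<zeta> = 2 * pi * n"
  then obtain n :: int where n: "log_height \<delta> l \<zeta> = 2 * pi * n" by blast
  define t where "t = (Re \<zeta> - ln \<delta>) / Re l"
  have "Re \<zeta> = ln \<delta> + t * Re l"
    using assms by (simp add: t_def)
  moreover have "Im \<zeta> = t * Im l + of_int (2 * n) * pi"
    using n by (simp add: log_height_def algebra_simps flip: t_def)
  ultimately have "\<zeta> = of_real (ln \<delta>) + of_real t * l + of_real (of_int (2 * n) * pi) * \<i>"
    by (intro complex_eqI) simp_all
  then have "exp \<zeta> = exp (of_real (ln \<delta>) + of_real t * l)"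
    unfolding exp_eq by blast
  also have "\<dots> = of_real \<delta> * exp (of_real t * l)"
    using assms by (simp add: exp_add exp_of_real)
  finally show "exp \<zeta> \<in> log_spiral \<delta> l"
    by (auto simp: log_spiral_def)
qed

lemma inj_on_exp_log_strip:
  "inj_on exp (log_strip \<delta> l)"
proof (rule inj_onI)
  fix x y assume x: "x \<in> log_strip \<delta> l" and y: "y \<in> log_strip \<delta> l" and "exp x = exp y"
  then obtain n :: int where n: "x = y + of_real (of_int (2 * n) * pi) * \<i>"
    unfolding exp_eq by blast
  then have "log_height \<delta> l x = log_height \<delta> l y + 2 * pi * n"
    by (simp only: log_height_add_period)
  then have "\<bar>2 * pi * n\<bar> < 2 * pi * 1"
    using x y unfolding log_strip_def mem_Collect_eq by linarith
  then have "\<bar>real_of_int n\<bar> < 1"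
    by (simp add: abs_mult)
  then have "n = 0" by linarith
  then show "x = y" using n by simp
qed

lemma exp_image_log_strip:
  assumes "0 < \<delta>" "Re l < 0"
  shows "exp ` log_strip \<delta> l = - log_spiral \<delta> l"
proof
  show "exp ` log_strip \<delta> l \<subseteq> - log_spiral \<delta> l"
  proof clarsimp
    fix \<zeta> assume \<zeta>: "\<zeta> \<in> log_strip \<delta> l" "exp \<zeta> \<in> log_spiral \<delta> l"
    then obtain n :: int where "log_height \<delta> l \<zeta> = 2 * pi * n"
      using exp_in_log_spiral_iff[OF assms] by blast
    then have "0 < 2 * pi * n" "2 * pi * n < 2 * pi * 1"
      using \<zeta> by (simp_all add: log_strip_def)
    then have "0 < real_of_int n" "real_of_int n < 1"
      by (simp_all add: zero_less_mult_iff)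
    then show False by simp
  qed
  show "- log_spiral \<delta> l \<subseteq> exp ` log_strip \<delta> l"
  proof
    fix w assume w: "w \<in> - log_spiral \<delta> l"
    then have "w \<noteq> 0" by (auto simp: log_spiral_def)
    define a where "a = log_height \<delta> l (Ln w)"
    define n where "n = - \<lfloor>a / (2 * pi)\<rfloor>"
    define \<zeta> where "\<zeta> = Ln w + of_real (of_int (2 * n) * pi) * \<i>"
    have e: "exp \<zeta> = w"
      using \<open>w \<noteq> 0\<close> exp_eq[of \<zeta> "Ln w"] by (auto simp: \<zeta>_def)
    have h: "log_height \<delta> l \<zeta> = a + 2 * pi * n"
      unfolding \<zeta>_def a_def by (rule log_height_add_period)
    have "- real_of_int n \<le> a / (2 * pi)" "a / (2 * pi) < - real_of_int n + 1"
      unfolding n_def by linarith+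
    then have "0 \<le> a + 2 * pi * n" "a + 2 * pi * n < 2 * pi"
      by (simp_all add: field_simps)
    moreover have "a + 2 * pi * n \<noteq> 0"
      using exp_in_log_spiral_iff[OF assms, of \<zeta>] w e unfolding h
      by (metis ComplD of_int_0 mult_zero_right)
    ultimately have "\<zeta> \<in> log_strip \<delta> l"
      by (simp add: log_strip_def h)
    then show "w \<in> exp ` log_strip \<delta> l" using e by blast
  qed
qed

lemma open_log_strip: "open (log_strip \<delta> l)"
  unfolding log_strip_def log_height_def divide_inverse
  by (intro open_Collect_conj open_Collect_less continuous_intros)

lemma convex_log_strip: "convex (log_strip \<delta> l)"
proof -
  \<comment> \<open>The height is an affine function with gradient \<open>a\<close>.\<close>
  define a where "a = Complex (- (Im l / Re l)) 1"
  have "log_strip \<delta> l = {\<zeta>. a \<bullet> \<zeta> > - (ln \<delta> / Re l * Im l)} \<inter> {\<zeta>. a \<bullet> \<zeta> < 2 * pi - ln \<delta> / Re l * Im l}"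
    by (auto simp: log_strip_def log_height_def a_def inner_complex_def diff_divide_distrib algebra_simps)
  then show ?thesis
    by (metis convex_Int convex_halfspace_lt convex_halfspace_gt)
qed

text \<open>The complement is the image of the open strip under an injective holomorphic map.\<close>

lemma closed_log_spiral:
  assumes "0 < \<delta>" "Re l < 0"
  shows "closed (log_spiral \<delta> l)"
proof -
  have "open (exp ` log_strip \<delta> l)"
    by (intro open_mapping_thm3 holomorphic_intros open_log_strip inj_on_exp_log_strip)
  then show ?thesis
    by (simp add: exp_image_log_strip[OF assms] closed_def)
qed

text \<open>A point of the spiral is determined by its absolute value, so rotating it slightly moves it off
  the spiral.\<close>

lemma log_spiral_avoided_by_open:
  assumes "0 < \<delta>" "Re l < 0" and X: "open X" "X \<noteq> {}"
  shows "\<exists>w\<in>X. w \<notin> log_spiral \<delta> l"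
proof (rule ccontr)
  assume "\<not> ?thesis"
  then have sub: "X \<subseteq> log_spiral \<delta> l" by blast
  have unique: "v = w" if vw: "v \<in> X" "w \<in> X" "norm v = norm w" "w \<noteq> 0" for v w
  proof -
    have "v \<noteq> 0" using vw by auto
    then obtain s t where st: "v = of_real \<delta> * exp (of_real s * l)" "w = of_real \<delta> * exp (of_real t * l)"
      using subsetD[OF sub vw(1)] subsetD[OF sub vw(2)] vw(4) by (auto simp: log_spiral_def)
    then have "\<delta> * exp (s * Re l) = \<delta> * exp (t * Re l)"
      using vw assms by (simp add: norm_spiral_point)
    then have "s = t" using assms by simp
    then show ?thesis using st by simp
  qed
  have "X \<noteq> {0}" using X not_open_singleton by metis
  then obtain w where w: "w \<in> X" "w \<noteq> 0" using X by blast
  have "((\<lambda>t::real. w * cis t) \<longlongrightarrow> w * cis 0) (at_right 0)"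
    unfolding cis_conv_exp by (intro tendsto_intros)
  then have "\<forall>\<^sub>F t in at_right 0. w * cis t \<in> X"
    using X w by (intro topological_tendstoD) auto
  moreover have "\<forall>\<^sub>F t in at_right 0. t \<in> {0<..<pi::real}"
    by (intro eventually_at_right_real) auto
  ultimately have "\<forall>\<^sub>F t in at_right 0. w * cis t \<in> X \<and> t \<in> {0<..<pi}"
    by eventually_elim auto
  then obtain t :: real where t: "w * cis t \<in> X" "t \<in> {0<..<pi}"
    using eventually_happens'[OF trivial_limit_at_right_real] by blast
  have "w * cis t = w"
    using t w by (intro unique) (auto simp: norm_mult)
  then have "cis t = 1" using w by simp
  then have "sin t = 0" by (metis cis.sel(2) one_complex.sel(2))
  then show False using t sin_gt_zero[of t] by auto
qed

lemma hausdorff_null_log_spiral: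
  assumes "0 < \<delta>" "1 < s"
  shows "hausdorff_measure s (log_spiral \<delta> l) = 0"
proof -
  define h where "h t = of_real \<delta> * exp (of_real t * l)" for t :: real
  have "hausdorff_measure s (h ` {a..a + 1}) = 0" for a
  proof (rule hausdorff_null_lipschitz_image)
    define R where "R = (\<bar>a\<bar> + 1) * norm l"
    fix x y assume xy: "x \<in> {a..a + 1}" "y \<in> {a..a + 1}"
    have in_ball: "of_real t * l \<in> cball 0 R" if "t \<in> {a..a + 1}" for t
    proof -
      have "\<bar>t\<bar> \<le> \<bar>a\<bar> + 1" using that by auto
      then show ?thesis by (auto simp: R_def norm_mult intro: mult_right_mono)
    qed
    have "norm (exp (of_real x * l) - exp (of_real y * l)) \<le> exp R * norm (of_real x * l - of_real y * l)"
    proof (rule field_differentiable_bound[of "cball 0 R" exp exp])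
      fix z assume "z \<in> cball (0::complex) R"
      then show "norm (exp z) \<le> exp R"
        using norm_exp[of z] by (auto intro: order_trans)
    qed (use in_ball xy in \<open>auto intro: DERIV_subset[OF DERIV_exp]\<close>)
    also have "\<dots> = exp R * norm l * dist x y"
      by (simp add: dist_norm left_diff_distrib[symmetric] norm_mult flip: of_real_diff)
    finally show "dist (h x) (h y) \<le> \<delta> * exp R * norm l * dist x y"
      using assms by (simp add: h_def dist_norm norm_mult right_diff_distrib[symmetric] mult.assoc)
  qed (use assms hausdorff_null_unit_interval in auto)
  then have "hausdorff_measure s (\<Union>((\<lambda>n::int. h ` {of_int n..of_int n + 1}) ` UNIV)) = 0"
    by (intro hausdorff_null_countable_Union) auto
  moreover have "hausdorff_measure s {0::complex} = 0"
    using assms by (intro hausdorff_null_countable) auto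
  ultimately have null: "hausdorff_measure s ({0} \<union> (\<Union>n::int. h ` {of_int n..of_int n + 1})) = 0"
    by (intro hausdorff_null_Un)
  have "t \<in> (\<Union>n::int. {of_int n..of_int n + 1})" for t :: real
    by (rule UN_I[of "\<lfloor>t\<rfloor>"]) (auto intro: less_imp_le)
  then have "log_spiral \<delta> l \<subseteq> {0} \<union> (\<Union>n::int. h ` {of_int n..of_int n + 1})"
    unfolding log_spiral_def h_def by fast
  with null show ?thesis by (rule hausdorff_null_subset)
qed

section \<open>Simply connected sets have no holes\<close>

text \<open>The components of the complement of a simply connected open set \<open>W\<close> in the plane are
  unbounded. On the sphere, \<open>\<infinity>\<close> lies in the closure of each of them, so adding it gives a connected
  set.\<close>

lemma simply_connected_imp_no_holes:
  assumes "open W" "simply_connected W"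
  shows "no_holes W"
  unfolding no_holes_def
proof
  let ?Y = "topspace riemann_sphere - Some ` W"
  fix C assume C: "C \<in> connected_components_of (subtopology riemann_sphere ?Y)"
  have top: "topspace riemann_sphere = UNIV"
    by (auto simp: riemann_sphere_def image_iff) 
  obtain x where x: "x \<in> C"
    using C nonempty_connected_components_of by fast
  show "None \<in> C"
  proof (cases x)
    case None
    then show ?thesis using x by simp
  next
    case (Some z)
    have "C \<subseteq> ?Y" using C connected_components_of_subset by fastforce
    then have z: "z \<in> - W" using Some x by auto
    define T where "T = connected_component_set (- W) z"
    have T: "T \<in> components (- W)" "z \<in> T"
      using z by (auto simp: T_def componentsI)
    then have unb: "\<not> bounded T"
      using assms simply_connected_eq_unbounded_complement_components[OF assms(1)] by blast
    have conn: "connectedin riemann_sphere (Some ` T)"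
      unfolding riemann_sphere_def
      by (intro connectedin_continuous_map_image[OF continuous_map_Some])
        (simp add: T_def connected_connected_component)
    have "None \<in> riemann_sphere closure_of (Some ` T)"
      unfolding in_closure_of
    proof (intro conjI allI impI)
      fix N assume "None \<in> N \<and> openin riemann_sphere N"
      then obtain K where K: "compact K" "N = insert None (Some ` (- K))"
        unfolding riemann_sphere_def openin_Alexandroff_compactification
        by (auto simp: Compl_eq_Diff_UNIV)
      have "\<not> T \<subseteq> K" using unb K by (meson bounded_subset compact_imp_bounded)
      then show "\<exists>y. y \<in> Some ` T \<and> y \<in> N" using K by auto
    qed (simp add: top)
    then have "connectedin riemann_sphere (insert None (Some ` T))"
      by (intro connectedin_intermediate_closure_of[OF conn])
        (auto intro: closure_of_subset[THEN subsetD] simp: top)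
    moreover have "insert None (Some ` T) \<subseteq> ?Y"
      using T(1) in_components_subset top by fastforce
    ultimately have "connectedin (subtopology riemann_sphere ?Y) (insert None (Some ` T))"
      by (simp add: connectedin_subtopology)
    moreover have "C \<inter> insert None (Some ` T) \<noteq> {}"
      using x Some T by auto
    ultimately have "insert None (Some ` T) \<subseteq> C"
      using C by (meson connected_components_of_maximal disjnt_def)
    then show ?thesis by simp
  qed
qed

section \<open>Values taken by an entire function\<close>

text \<open>Polynomials are surjective; otherwise the point at infinity is an essential singularity, and by
  the great Picard theorem all values but at most one are taken infinitely often, hence also at
  points other than the exceptional value itself. In this form the statement can be iterated.\<close>

lemma entire_backward_step:
  assumes f: "f holomorphic_on UNIV" and nonconst: "\<not> f constant_on UNIV"
  obtains e E where "E \<subseteq> {e :: complex}" "\<And>w. w \<notin> E \<Longrightarrow> \<exists>z. z \<notin> E \<and> f z = w"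
proof (cases "\<exists>(a :: nat \<Rightarrow> complex) n. \<forall>z. f z = (\<Sum>i\<le>n. a i * z ^ i)")
  case True
  then obtain a :: "nat \<Rightarrow> complex" and n where f_eq: "\<And>z. f z = (\<Sum>i\<le>n. a i * z ^ i)" by blast
  have "\<exists>z. f z = w" for w
  proof -
    have "\<exists>i\<in>{1..n}. a i \<noteq> 0"
    proof (rule ccontr)
      assume "\<not> ?thesis"
      then have "f z = a 0" for z
        unfolding f_eq by (subst sum.remove[of _ 0]) (auto intro!: sum.neutral)
      then show False using nonconst by (auto simp: constant_on_def)
    qed
    then obtain z where "(\<Sum>i\<le>n. (a(0 := a 0 - w)) i * z ^ i) = 0"
      by (rule_tac fundamental_theorem_of_algebra[of "a(0 := a 0 - w)" n]) auto
    moreover have "(\<Sum>i\<le>n. (a(0 := a 0 - w)) i * z ^ i) = f z - w"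
      unfolding f_eq by (simp add: sum.remove[of "{..n}" 0])
    ultimately show ?thesis by (intro exI[of _ z]) simp
  qed
  then show thesis by (intro that[of "{}" 0]) auto
next
  case False
  \<comment> \<open>A limit of \<open>1 / f\<close> at infinity would make \<open>f\<close> a polynomial, a limit of \<open>f\<close> a constant.\<close>
  have no_pole: "\<not> ((inverse \<circ> f) \<longlongrightarrow> b) at_infinity" for b
    using pole_at_infinity[OF f, of b] False by metis
  have no_lim: "\<not> (f \<longlongrightarrow> b) at_infinity" for b
    using Liouville_weak[OF f] nonconst by (metis constant_on_def)
  have "(f \<circ> inverse) holomorphic_on (UNIV - {0})"
    by (intro holomorphic_on_compose_gen[OF _ f] holomorphic_intros) auto
  then obtain a where a: "\<And>w. w \<noteq> a \<Longrightarrow> infinite {x \<in> UNIV - {0}. (f \<circ> inverse) x = w}"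
  proof (rule great_Picard_infinite[rotated 2])
    show "\<not> ((f \<circ> inverse) \<longlongrightarrow> b) (at 0)" for b
      using no_lim[of b] by (simp add: lim_at_infinity_0)
    show "\<not> ((inverse \<circ> (f \<circ> inverse)) \<longlongrightarrow> b) (at 0)" for b
      using no_pole[of b] by (simp add: lim_at_infinity_0 o_assoc)
  qed (use that in auto)
  have "\<exists>z. z \<notin> {a} \<and> f z = w" if "w \<notin> {a}" for w
  proof -
    have "infinite ({x \<in> UNIV - {0}. (f \<circ> inverse) x = w} - {inverse a})"
      using a that by simp
    then have "{x \<in> UNIV - {0}. (f \<circ> inverse) x = w} - {inverse a} \<noteq> {}"
      by (rule infinite_imp_nonempty)
    then obtain x where "x \<noteq> inverse a" "f (inverse x) = w"
      by auto
    then show ?thesis by (intro exI[of _ "inverse x"]) auto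
  qed
  then show thesis by (intro that[of "{a}" a]) auto
qed

lemma iterate_preimage:
  assumes "\<And>w. w \<notin> E \<Longrightarrow> \<exists>z. z \<notin> E \<and> f z = w" "w \<notin> E"
  shows "\<exists>z. z \<notin> E \<and> (f ^^ n) z = w"
  using assms(2)
proof (induction n arbitrary: w)
  case (Suc n)
  then obtain v where "v \<notin> E" "f v = w" using assms(1) by blast
  then show ?case using Suc.IH[of v] by auto
qed auto

section \<open>Holomorphic preliminaries\<close>

lemma simply_connected_injective_holomorphic_image:
  assumes "h holomorphic_on S" "open S" "inj_on h S" "simply_connected S"
  shows "simply_connected (h ` S)"
proof -
  obtain k where k: "k holomorphic_on (h ` S)" "\<And>z. z \<in> S \<Longrightarrow> k (h z) = z"
    using holomorphic_has_inverse[OF assms(1-3)] by metis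
  have "homeomorphism S (h ` S) h k"
    using k assms by (intro homeomorphismI) (auto intro: holomorphic_on_imp_continuous_on)
  then show ?thesis
    using assms(4) homeomorphic_simply_connected_eq homeomorphic_def by blast
qed

text \<open>The exponential function maps the part of the strip to the left of the line \<open>Re \<zeta> = ln \<eta>\<close>,
  a convex set, injectively onto this slit disc.\<close>

lemma simply_connected_ball_minus_log_spiral:
  assumes "0 < \<delta>" "Re l < 0" "0 < \<eta>"
  shows "simply_connected (ball 0 \<eta> - log_spiral \<delta> l)"
proof -
  let ?S = "log_strip \<delta> l \<inter> {\<zeta>. Re \<zeta> < ln \<eta>}"
  have "ball 0 \<eta> - log_spiral \<delta> l = exp ` ?S"
  proof -
    have "norm (exp \<zeta>) < \<eta> \<longleftrightarrow> Re \<zeta> < ln \<eta>" for \<zeta>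
      using assms by (simp add: norm_exp_eq_Re) (metis exp_less_cancel_iff exp_ln)
    moreover have "ball 0 \<eta> - log_spiral \<delta> l = {w \<in> exp ` log_strip \<delta> l. norm w < \<eta>}"
      unfolding exp_image_log_strip[OF assms(1,2)] by auto
    ultimately show ?thesis by auto
  qed
  moreover have "simply_connected (exp ` ?S)"
    using convex_log_strip open_log_strip
    by (intro simply_connected_injective_holomorphic_image holomorphic_intros
        convex_imp_simply_connected convex_Int open_Int)
      (auto simp: convex_halfspace_Re_lt open_halfspace_Re_lt intro: inj_on_subset[OF inj_on_exp_log_strip])
  ultimately show ?thesis by simp
qed

text \<open>Near a point where the derivative is not \<open>0\<close>, a holomorphic map expands distances by at least a
  constant factor, so its local inverse is Lipschitz.\<close>

lemma holomorphic_locally_expanding: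
  assumes h: "h holomorphic_on S" "open S" "z \<in> S" and d: "deriv h z \<noteq> 0"
  obtains r where "0 < r" "ball z r \<subseteq> S"
    "\<And>x y. x \<in> ball z r \<Longrightarrow> y \<in> ball z r \<Longrightarrow>
       norm (x - y) \<le> 2 / norm (deriv h z) * norm (h x - h y)"
proof -
  define c where "c = norm (deriv h z)"
  have c: "0 < c" using d by (simp add: c_def)
  have "isCont (deriv h) z"
    using h by (meson continuous_on_eq_continuous_at holomorphic_deriv holomorphic_on_imp_continuous_on)
  then have "\<forall>\<^sub>F x in at z. dist (deriv h x) (deriv h z) < c / 2"
    using c unfolding isCont_def by (intro tendstoD) auto
  then have "\<forall>\<^sub>F x in nhds z. dist (deriv h x) (deriv h z) < c / 2"
    using c by (simp add: eventually_nhds_conv_at)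
  moreover have "\<forall>\<^sub>F x in nhds z. x \<in> S" using h by (intro eventually_nhds_in_open)
  ultimately have "\<forall>\<^sub>F x in nhds z. dist (deriv h x) (deriv h z) < c / 2 \<and> x \<in> S"
    by eventually_elim auto
  then obtain r where r: "0 < r" "\<And>x. dist x z < r \<Longrightarrow> dist (deriv h x) (deriv h z) < c / 2 \<and> x \<in> S"
    unfolding eventually_nhds_metric by blast
  show thesis
  proof (rule that[OF r(1)])
    show sub: "ball z r \<subseteq> S" using r(2) by (auto simp: dist_commute)
    fix x y assume xy: "x \<in> ball z r" "y \<in> ball z r"
    let ?k = "\<lambda>w. h w - deriv h z * w"
    have "norm (?k x - ?k y) \<le> c / 2 * norm (x - y)"
    proof (rule field_differentiable_bound[of "ball z r"])
      fix w assume w: "w \<in> ball z r"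
      then have "(h has_field_derivative deriv h w) (at w within ball z r)"
        using sub h by (meson holomorphic_derivI subsetD DERIV_subset subset_UNIV)
      then show "(?k has_field_derivative (deriv h w - deriv h z)) (at w within ball z r)"
        by (auto intro!: derivative_eq_intros)
      show "norm (deriv h w - deriv h z) \<le> c / 2"
        using r(2)[of w] w by (simp add: dist_norm norm_minus_commute less_imp_le)
    qed (use xy in auto)
    moreover have "c * norm (x - y) = norm (deriv h z * x - deriv h z * y)"
      by (simp add: c_def norm_mult[symmetric] right_diff_distrib)
    moreover have "norm (deriv h z * x - deriv h z * y) \<le> norm (h x - h y) + norm (?k x - ?k y)"
      by (rule order_trans[OF _ norm_triangle_ineq4]) (simp add: algebra_simps)
    ultimately have "c * norm (x - y) \<le> 2 * norm (h x - h y)"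
      by linarith
    then show "norm (x - y) \<le> 2 / norm (deriv h z) * norm (h x - h y)"
      using c by (simp add: c_def field_simps)
  qed
qed

text \<open>Off the critical points, countably many neighbourhoods on which \<open>h\<close> has a Lipschitz inverse
  suffice, by Lindelof.\<close>

lemma hausdorff_null_holomorphic_preimage:
  assumes h: "h holomorphic_on S" "open S" and crit: "countable {z \<in> S. deriv h z = 0}"
    and s: "0 < s" and null: "hausdorff_measure s T = 0"
  shows "hausdorff_measure s {z \<in> S. h z \<in> T} = 0"
proof -
  let ?R = "{z \<in> S. deriv h z \<noteq> 0}"
  have local: "\<exists>N. open N \<and> z \<in> N \<and> hausdorff_measure s (N \<inter> {z \<in> S. h z \<in> T}) = 0"
    if z: "z \<in> ?R" for z
  proof -
    obtain r where r: "0 < r" "ball z r \<subseteq> S"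
      "\<And>x y. x \<in> ball z r \<Longrightarrow> y \<in> ball z r \<Longrightarrow>
         norm (x - y) \<le> 2 / norm (deriv h z) * norm (h x - h y)"
      using holomorphic_locally_expanding[OF h, of z] z by auto
    let ?N = "ball z r \<inter> {z \<in> S. h z \<in> T}"
    have inj: "inj_on h ?N"
      using r(3) by (intro inj_onI) force
    have "hausdorff_measure s (h ` ?N) = 0"
      by (rule hausdorff_null_subset[OF null]) auto
    then have "hausdorff_measure s (inv_into ?N h ` (h ` ?N)) = 0"
    proof (rule hausdorff_null_lipschitz_image[OF s])
      fix u v assume "u \<in> h ` ?N" "v \<in> h ` ?N"
      then obtain x y where "x \<in> ?N" "y \<in> ?N" "u = h x" "v = h y" by blast
      then show "dist (inv_into ?N h u) (inv_into ?N h v) \<le> 2 / norm (deriv h z) * dist u v"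
        using r(3)[of x y] inv_into_f_f[OF inj] by (simp add: dist_norm)
    qed
    moreover have "inv_into ?N h ` (h ` ?N) = ?N"
      using inj by (rule inv_into_image_cancel) simp
    ultimately show ?thesis
      using r(1) by (intro exI[of _ "ball z r"]) simp
  qed
  have "\<exists>N. \<forall>z\<in>?R. open (N z) \<and> z \<in> N z \<and>
      hausdorff_measure s (N z \<inter> {z \<in> S. h z \<in> T}) = 0"
    by (rule bchoice) (intro ballI local)
  then obtain N where "\<forall>z\<in>?R. open (N z) \<and> z \<in> N z \<and>
      hausdorff_measure s (N z \<inter> {z \<in> S. h z \<in> T}) = 0" ..
  note N = bspec[OF this]
  have openN: "open X" if "X \<in> N ` ?R" for X
    using that N by blast
  have "\<exists>\<F>. \<F> \<subseteq> N ` ?R \<and> countable \<F> \<and> \<Union>\<F> = \<Union>(N ` ?R)"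
    by (rule Lindelof[OF openN]) (assumption, intro exI conjI)
  then obtain \<F> where \<F>: "\<F> \<subseteq> N ` ?R" "countable \<F>" "\<Union>\<F> = \<Union>(N ` ?R)"
    by blast
  have "hausdorff_measure s (\<Union>((\<lambda>X. X \<inter> {z \<in> S. h z \<in> T}) ` \<F>)) = 0"
  proof (rule hausdorff_null_countable_Union)
    fix X assume "X \<in> (\<lambda>X. X \<inter> {z \<in> S. h z \<in> T}) ` \<F>"
    then obtain z where "z \<in> ?R" "X = N z \<inter> {z \<in> S. h z \<in> T}" using \<F>(1) by blast
    then show "hausdorff_measure s X = 0" using N by blast
  qed (use \<F> in auto)
  then have "hausdorff_measure s (\<Union>((\<lambda>X. X \<inter> {z \<in> S. h z \<in> T}) ` \<F>) \<union> {z \<in> S. deriv h z = 0}) = 0"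
    using hausdorff_null_countable[OF s crit] by (rule hausdorff_null_Un)
  then show ?thesis
  proof (rule hausdorff_null_subset)
    show "{z \<in> S. h z \<in> T} \<subseteq> \<Union>((\<lambda>X. X \<inter> {z \<in> S. h z \<in> T}) ` \<F>) \<union> {z \<in> S. deriv h z = 0}"
    proof
      fix z assume z: "z \<in> {z \<in> S. h z \<in> T}"
      show "z \<in> \<Union>((\<lambda>X. X \<inter> {z \<in> S. h z \<in> T}) ` \<F>) \<union> {z \<in> S. deriv h z = 0}"
      proof (cases "deriv h z = 0")
        case False
        then have "z \<in> \<Union>\<F>" using z N \<F>(3) by blast
        then show ?thesis using z by blast
      qed (use z in auto)
    qed
  qed
qed

lemma uniform_limit_imp_holomorphic:
  assumes "open S" "uniform_limit S F \<psi> sequentially"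
    and "\<forall>\<^sub>F k in sequentially. F k holomorphic_on S"
  shows "\<psi> holomorphic_on S"
proof -
  have "\<psi> field_differentiable at w" if w: "w \<in> S" for w
  proof -
    obtain e where e: "0 < e" "cball w e \<subseteq> S"
      using assms(1) w open_contains_cball_eq by blast
    have "\<forall>\<^sub>F k in sequentially. continuous_on (cball w e) (F k) \<and> F k holomorphic_on ball w e"
      using assms(3)
    proof eventually_elim
      case (elim k)
      then show ?case
        using e by (meson ball_subset_cball holomorphic_on_imp_continuous_on holomorphic_on_subset order_trans)
    qed
    moreover have "uniform_limit (cball w e) F \<psi> sequentially"
      using assms(2) e by (metis uniform_limit_on_subset)
    ultimately have "\<psi> holomorphic_on ball w e"
      using holomorphic_uniform_limit sequentially_bot by metis
    then show ?thesis
      using e by (meson centre_in_ball holomorphic_on_imp_differentiable_at open_ball)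
  qed
  then show ?thesis
    using assms(1) by (simp add: holomorphic_on_def field_differentiable_at_within)
qed

section \<open>The dynamics in the chart\<close>

locale koenigs_chart =
  fixes f \<phi> \<Phi> :: "complex \<Rightarrow> complex" and z0 lam l :: complex
    and U :: "complex set" and \<delta> :: real
  assumes entire: "f holomorphic_on UNIV"
    and nonconstant: "\<not> f constant_on UNIV"
    and fixed_point: "f z0 = z0"
    and lam: "lam \<noteq> 0" "norm lam < 1"
    and U: "open U" "z0 \<in> U" "f ` U \<subseteq> U"
    and \<delta>: "0 < \<delta>"
    and conformal: "conformal_map \<phi> U (ball 0 \<delta>)"
    and \<phi>_f: "z \<in> U \<Longrightarrow> \<phi> (f z) = lam * \<phi> z"
    and \<Phi>_holomorphic: "\<Phi> holomorphic_on attraction_basin f z0"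
    and \<Phi>_eq_\<phi>: "z \<in> U \<Longrightarrow> \<Phi> z = \<phi> z"
    and \<Phi>_iterate: "z \<in> attraction_basin f z0 \<Longrightarrow> \<Phi> ((f ^^ n) z) = lam ^ n * \<Phi> z"
    and exp_l: "exp l = lam"
begin

abbreviation basin :: "complex set" where "basin \<equiv> attraction_basin f z0"
abbreviation spiral :: "complex set" where "spiral \<equiv> log_spiral \<delta> l"
abbreviation G0 :: "complex set" where "G0 \<equiv> G0_set f U \<phi> \<delta> l"

definition \<rho> :: "complex \<Rightarrow> complex" where "\<rho> = inv_into U \<phi>"

lemma Re_l: "Re l < 0"
  using lam(2) unfolding exp_l[symmetric] norm_exp_eq_Re by simp

lemma closed_spiral: "closed spiral"
  using closed_log_spiral[OF \<delta> Re_l] .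

lemma zero_in_spiral: "0 \<in> spiral"
  by (simp add: log_spiral_def)

lemma lam_power_spiral: "lam ^ n * w \<in> spiral \<longleftrightarrow> w \<in> spiral"
  unfolding exp_l[symmetric] by (rule log_spiral_mult_exp)

lemma \<phi>_holomorphic: "\<phi> holomorphic_on U" and \<phi>_inj: "inj_on \<phi> U"
  and \<phi>_image: "\<phi> ` U = ball 0 \<delta>"
  using conformal by (auto simp: conformal_map_def bij_betw_def)

lemma \<phi>_in_ball: "z \<in> U \<Longrightarrow> \<phi> z \<in> ball 0 \<delta>"
  using \<phi>_image by blast

lemma \<rho>_\<phi>: "z \<in> U \<Longrightarrow> \<rho> (\<phi> z) = z"
  unfolding \<rho>_def by (rule inv_into_f_f[OF \<phi>_inj])

lemma \<phi>_\<rho>: "w \<in> ball 0 \<delta> \<Longrightarrow> \<phi> (\<rho> w) = w"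
  and \<rho>_in_U: "w \<in> ball 0 \<delta> \<Longrightarrow> \<rho> w \<in> U"
  unfolding \<rho>_def \<phi>_image[symmetric] by (auto intro: f_inv_into_f inv_into_into)

lemma \<rho>_holomorphic: "\<rho> holomorphic_on ball 0 \<delta>"
proof -
  obtain k where k: "k holomorphic_on (\<phi> ` U)" "\<And>z. z \<in> U \<Longrightarrow> k (\<phi> z) = z"
    using holomorphic_has_inverse[OF \<phi>_holomorphic U(1) \<phi>_inj] by metis
  have "k w = \<rho> w" if "w \<in> ball 0 \<delta>" for w
    using k(2)[OF \<rho>_in_U[OF that]] \<phi>_\<rho>[OF that] by simp
  then show ?thesis
    using k(1) unfolding \<phi>_image by (metis (no_types, lifting) holomorphic_transform)
qed

lemma \<rho>_inj: "inj_on \<rho> (ball 0 \<delta>)"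
  by (rule inj_on_inverseI[of _ \<phi>]) (rule \<phi>_\<rho>)

lemma \<phi>_z0: "\<phi> z0 = 0"
proof -
  have "\<phi> z0 = lam * \<phi> z0"
    using \<phi>_f[OF U(2)] by (simp add: fixed_point)
  moreover have "lam \<noteq> 1" using lam by auto
  ultimately show ?thesis by simp
qed

lemma \<rho>_0: "\<rho> 0 = z0"
  using \<rho>_\<phi>[OF U(2)] by (simp add: \<phi>_z0)

lemma iterate_in_U: "z \<in> U \<Longrightarrow> (f ^^ n) z \<in> U"
  using U(3) by (induction n) auto

lemma iterate_in_U_mono: "(f ^^ n) z \<in> U \<Longrightarrow> n \<le> m \<Longrightarrow> (f ^^ m) z \<in> U"
  using iterate_in_U[of "(f ^^ n) z" "m - n"] by (metis comp_apply funpow_add le_add_diff_inverse2)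

lemma \<phi>_iterate: "z \<in> U \<Longrightarrow> \<phi> ((f ^^ n) z) = lam ^ n * \<phi> z"
  by (induction n) (auto simp: \<phi>_f iterate_in_U)

lemma lam_power_in_ball: "w \<in> ball 0 r \<Longrightarrow> lam ^ n * w \<in> ball 0 r"
proof -
  have "norm lam ^ n \<le> 1"
    using lam by (intro power_le_one) auto
  then have "norm (lam ^ n * w) \<le> 1 * norm w"
    unfolding norm_mult norm_power by (intro mult_right_mono) auto
  then show "w \<in> ball 0 r \<Longrightarrow> lam ^ n * w \<in> ball 0 r" by simp
qed

lemma lam_power_tendsto_0: "(\<lambda>n. lam ^ n * w) \<longlonglongrightarrow> 0"
  using tendsto_mult_left_zero[OF LIMSEQ_power_zero[OF lam(2)], of w] .

lemma iterate_\<rho>: "w \<in> ball 0 \<delta> \<Longrightarrow> (f ^^ n) (\<rho> w) = \<rho> (lam ^ n * w)"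
  using \<rho>_\<phi>[OF iterate_in_U[OF \<rho>_in_U], of w n] by (simp add: \<phi>_iterate \<rho>_in_U \<phi>_\<rho>)

lemma U_subset_basin: "U \<subseteq> basin"
proof
  fix z assume z: "z \<in> U"
  have "(\<lambda>n. \<rho> (lam ^ n * \<phi> z)) \<longlonglongrightarrow> \<rho> 0"
    using continuous_on_interior[OF holomorphic_on_imp_continuous_on[OF \<rho>_holomorphic], of 0] \<delta>
    by (intro isCont_tendsto_compose[of 0 \<rho>] lam_power_tendsto_0) auto
  moreover have "\<rho> (lam ^ n * \<phi> z) = (f ^^ n) z" for n
    using iterate_\<rho>[OF \<phi>_in_ball[OF z]] \<rho>_\<phi>[OF z] by simp
  ultimately show "z \<in> basin" by (simp add: attraction_basin_def \<rho>_0)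
qed

lemma basin_iff: "z \<in> basin \<longleftrightarrow> (\<exists>n. (f ^^ n) z \<in> U)"
proof
  assume "z \<in> basin"
  then have "\<forall>\<^sub>F n in sequentially. (f ^^ n) z \<in> U"
    unfolding attraction_basin_def using U by (auto intro: topological_tendstoD)
  then show "\<exists>n. (f ^^ n) z \<in> U"
    using eventually_happens'[OF sequentially_bot] by blast
next
  assume "\<exists>n. (f ^^ n) z \<in> U"
  then obtain n where "(f ^^ n) z \<in> basin" using U_subset_basin by blast
  then have "(\<lambda>m. (f ^^ (m + n)) z) \<longlonglongrightarrow> z0"
    by (simp add: attraction_basin_def funpow_add)
  then show "z \<in> basin"
    by (simp add: attraction_basin_def LIMSEQ_offset)
qed

lemma iterate_holomorphic: "(f ^^ n) holomorphic_on UNIV"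
proof (induction n)
  case (Suc n)
  then show ?case
    using holomorphic_on_compose_gen[OF Suc entire] by (simp add: o_def)
qed (simp add: id_def)

lemma open_vimage_iterate: "open X \<Longrightarrow> open ((f ^^ n) -` X)"
  using holomorphic_on_imp_continuous_on[OF iterate_holomorphic[of n]] by (rule open_vimage[rotated])

lemma open_image_iterate: "open X \<Longrightarrow> open ((f ^^ n) ` X)"
proof (induction n)
  case (Suc n)
  have "open (f ` ((f ^^ n) ` X))"
    by (intro open_mapping_thm[OF entire _ _ Suc.IH[OF Suc.prems] _ nonconstant]) auto
  then show ?case by (simp add: image_comp o_def)
qed auto

lemma open_basin: "open basin"
proof -
  have "basin = (\<Union>n. (f ^^ n) -` U)" using basin_iff by auto
  then show ?thesis using open_vimage_iterate[OF U(1)] by auto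
qed

lemma \<phi>_iterate_eq_\<Phi>:
  assumes "(f ^^ n) z \<in> U"
  shows "\<phi> ((f ^^ n) z) = lam ^ n * \<Phi> z"
proof -
  have "z \<in> basin" using assms basin_iff by blast
  then show ?thesis using \<Phi>_iterate[of z n] \<Phi>_eq_\<phi>[OF assms] by simp
qed

text \<open>The values of \<open>\<Phi>\<close> determine the orbit once it has reached the chart.\<close>

lemma iterate_eq_\<rho>:
  assumes "(f ^^ n) z \<in> U"
  shows "(f ^^ n) z = \<rho> (lam ^ n * \<Phi> z)" "lam ^ n * \<Phi> z \<in> ball 0 \<delta>"
  using \<rho>_\<phi>[OF assms] \<phi>_in_ball[OF assms] unfolding \<phi>_iterate_eq_\<Phi>[OF assms] by simp_all

text \<open>Since the spiral is invariant under multiplication by \<open>\<lambda>\<close>, the union over all \<open>n\<close> in the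
  definition of \<open>G\<^sub>0\<close> reduces to one condition on \<open>\<Phi>\<close>.\<close>

lemma G0_eq: "G0 = {z \<in> basin. \<Phi> z \<notin> spiral}"
proof -
  have "(f ^^ n) z \<in> U0_set U \<phi> \<delta> l \<longleftrightarrow> (f ^^ n) z \<in> U \<and> \<Phi> z \<notin> spiral" for n z
  proof (cases "(f ^^ n) z \<in> U")
    case True
    show ?thesis
      using True \<phi>_in_ball[OF True] \<phi>_iterate_eq_\<Phi>[OF True]
      by (simp add: U0_set_def ball_minus_S0_set[OF \<delta> Re_l] lam_power_spiral)
  qed (simp add: U0_set_def)
  then show ?thesis
    unfolding G0_set_def using basin_iff by auto
qed

lemma G0_subset_basin: "G0 \<subseteq> basin"
  using G0_eq by auto

lemma open_G0: "open G0"
proof -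
  have "open (basin \<inter> \<Phi> -` (- spiral))"
    using closed_spiral
    by (intro continuous_open_preimage holomorphic_on_imp_continuous_on \<Phi>_holomorphic open_basin) auto
  moreover have "G0 = basin \<inter> \<Phi> -` (- spiral)" by (auto simp: G0_eq)
  ultimately show ?thesis by simp
qed

lemma G0_disjoint_backward_orbit: "G0 \<inter> backward_orbit f z0 = {}"
proof -
  have "\<Phi> z = 0" if "z \<in> basin" "(f ^^ n) z = z0" for z n
    using \<Phi>_iterate[OF that(1), of n] that(2) \<Phi>_eq_\<phi>[OF U(2)] \<phi>_z0 lam(1) by simp
  then show ?thesis
    using zero_in_spiral by (fastforce simp: G0_eq backward_orbit_def)
qed

text \<open>The basin need not be connected, so the open mapping theorem is not applied to \<open>\<Phi>\<close> itself but to
  the factors of \<open>\<Phi> = \<lambda>\<^sup>-\<^sup>n \<cdot> (\<phi> \<circ> f\<^sup>n)\<close>, which holds on \<open>f\<^sup>-\<^sup>n(U)\<close>.\<close>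

lemma open_image_\<Phi>:
  assumes X: "open X" "X \<subseteq> basin"
  shows "open (\<Phi> ` X)"
proof (subst open_subopen, rule ballI)
  fix w assume "w \<in> \<Phi> ` X"
  then obtain z where z: "z \<in> X" "w = \<Phi> z" by blast
  then obtain n where n: "(f ^^ n) z \<in> U" using X basin_iff by blast
  define Y where "Y = X \<inter> (f ^^ n) -` U"
  have Y: "open Y" "Y \<subseteq> X" "z \<in> Y"
    using z n X open_vimage_iterate[OF U(1)] by (auto simp: Y_def)
  have sub: "(f ^^ n) ` Y \<subseteq> U" by (auto simp: Y_def)
  have "open (\<phi> ` ((f ^^ n) ` Y))"
    by (rule open_mapping_thm3[OF holomorphic_on_subset[OF \<phi>_holomorphic sub]
          open_image_iterate[OF Y(1)] inj_on_subset[OF \<phi>_inj sub]])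
  moreover have "open ((\<lambda>v. inverse (lam ^ n) * v) ` V)" if "open V" for V
    by (rule open_mapping_thm3) (use lam that in \<open>auto intro!: holomorphic_intros inj_onI\<close>)
  ultimately have "open ((\<lambda>v. inverse (lam ^ n) * v) ` (\<phi> ` ((f ^^ n) ` Y)))"
    by blast
  moreover have "(\<lambda>v. inverse (lam ^ n) * v) ` (\<phi> ` ((f ^^ n) ` Y)) = \<Phi> ` Y"
    unfolding image_image
  proof (rule image_cong[OF refl])
    fix y assume "y \<in> Y"
    then have "\<phi> ((f ^^ n) y) = lam ^ n * \<Phi> y"
      using sub by (intro \<phi>_iterate_eq_\<Phi>) auto
    then show "inverse (lam ^ n) * \<phi> ((f ^^ n) y) = \<Phi> y"
      using lam by simp
  qed
  ultimately have "open (\<Phi> ` Y)" by simp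
  then show "\<exists>T. open T \<and> w \<in> T \<and> T \<subseteq> \<Phi> ` X"
    using Y z by blast
qed

text \<open>The open map \<open>\<Phi>\<close> cannot send a whole neighbourhood into the spiral.\<close>

lemma basin_subset_closure_G0: "basin \<subseteq> closure G0"
proof
  fix z assume z: "z \<in> basin"
  show "z \<in> closure G0"
    unfolding closure_iff_nhds_not_empty
  proof (intro allI impI)
    fix S N assume "N \<subseteq> S" "open N" "z \<in> N"
    then have N: "open (N \<inter> basin)" "z \<in> N \<inter> basin"
      using z open_basin by auto
    then have "open (\<Phi> ` (N \<inter> basin))" "\<Phi> ` (N \<inter> basin) \<noteq> {}"
      using open_image_\<Phi>[of "N \<inter> basin"] by auto
    then obtain w where "w \<in> \<Phi> ` (N \<inter> basin)" "w \<notin> spiral"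
      using log_spiral_avoided_by_open[OF \<delta> Re_l] by blast
    then show "G0 \<inter> S \<noteq> {}"
      using \<open>N \<subseteq> S\<close> by (auto simp: G0_eq)
  qed
qed

section \<open>The dimension of the exceptional set\<close>

text \<open>On \<open>f\<^sup>-\<^sup>n(U)\<close> the function \<open>\<Phi>\<close> is, up to a factor, the injective \<open>\<phi>\<close> after \<open>f\<^sup>n\<close>, so its
  critical points there are critical points of the entire function \<open>f\<^sup>n\<close>.\<close>

lemma countable_critical_points: "countable {z \<in> basin. deriv \<Phi> z = 0}"
proof (rule countable_subset)
  show "{z \<in> basin. deriv \<Phi> z = 0} \<subseteq> (\<Union>n. {z. deriv (f ^^ n) z = 0})"
  proof clarsimp
    fix z assume z: "z \<in> basin" "deriv \<Phi> z = 0"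
    then obtain n where n: "(f ^^ n) z \<in> U" using basin_iff by blast
    have d\<Phi>: "(\<Phi> has_field_derivative 0) (at z)"
      using holomorphic_derivI[OF \<Phi>_holomorphic open_basin z(1)] z(2) by simp
    have "((\<lambda>x. lam ^ n * \<Phi> x) has_field_derivative lam ^ n * 0) (at z)"
      by (rule DERIV_cmult[OF d\<Phi>])
    moreover have "\<forall>\<^sub>F x in nhds z. \<phi> ((f ^^ n) x) = lam ^ n * \<Phi> x"
    proof -
      have "\<forall>\<^sub>F x in nhds z. x \<in> (f ^^ n) -` U"
        using n open_vimage_iterate[OF U(1)] by (intro eventually_nhds_in_open) auto
      then show ?thesis
        by eventually_elim (simp add: \<phi>_iterate_eq_\<Phi>)
    qed
    ultimately have "((\<lambda>x. \<phi> ((f ^^ n) x)) has_field_derivative 0) (at z)"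
      using DERIV_cong_ev[OF refl, of "\<lambda>x. \<phi> ((f ^^ n) x)" "\<lambda>x. lam ^ n * \<Phi> x" z "lam ^ n * 0" 0]
      by simp
    moreover have "((\<lambda>x. \<phi> ((f ^^ n) x)) has_field_derivative
        deriv \<phi> ((f ^^ n) z) * deriv (f ^^ n) z) (at z)"
      using DERIV_chain2[OF holomorphic_derivI[OF \<phi>_holomorphic U(1) n]
          holomorphic_derivI[OF iterate_holomorphic open_UNIV UNIV_I]] .
    ultimately have "deriv \<phi> ((f ^^ n) z) * deriv (f ^^ n) z = 0"
      using DERIV_unique by blast
    then show "\<exists>n. deriv (f ^^ n) z = 0"
      using holomorphic_injective_imp_regular[OF \<phi>_holomorphic U(1) \<phi>_inj n] by auto
  qed
  have "countable {z. deriv (f ^^ n) z = 0}" for n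
  proof (cases "deriv (f ^^ n) constant_on UNIV")
    case True
    then obtain c where c: "\<And>z. deriv (f ^^ n) z = c" by (auto simp: constant_on_def)
    have "c \<noteq> 0"
    proof
      assume "c = 0"
      then have "((f ^^ n) has_field_derivative 0) (at z)" for z
        using holomorphic_derivI[OF iterate_holomorphic[of n] open_UNIV UNIV_I, of z] c by simp
      then have "\<exists>b. \<forall>z\<in>UNIV. (f ^^ n) z = b"
        by (intro has_field_derivative_zero_constant) auto
      then obtain b where "range (f ^^ n) = {b}" by fastforce
      then show False using open_image_iterate[OF open_UNIV, of n] by (simp add: not_open_singleton)
    qed
    then show ?thesis by (simp add: c)
  next
    case False
    then show ?thesis
      using holomorphic_countable_zeros[of "deriv (f ^^ n)" UNIV]
        holomorphic_deriv[OF iterate_holomorphic open_UNIV]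
      by (simp add: connected_UNIV)
  qed
  then show "countable (\<Union>n. {z. deriv (f ^^ n) z = 0})" by simp
qed

lemma basin_minus_G0: "basin - G0 = {z \<in> basin. \<Phi> z \<in> spiral}"
  by (auto simp: G0_eq)

text \<open>As a preimage of the spiral under \<open>\<Phi>\<close> the set is null in every dimension above \<open>1\<close>; as it
  contains the copy \<open>\<rho>(S\<^sub>0)\<close> of the spiral in \<open>U\<close>, it is not null in dimensions up to \<open>1\<close>.\<close>

lemma hausdorff_dim_basin_minus_G0: "hausdorff_dim (basin - G0) = 1"
proof -
  have null: "hausdorff_measure s (basin - G0) = 0" if "1 < s" for s
    unfolding basin_minus_G0
    using that hausdorff_null_log_spiral[OF \<delta> that, of l]
    by (intro hausdorff_null_holomorphic_preimage[OF \<Phi>_holomorphic open_basin countable_critical_points])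
      auto
  have not_null: "1 < s" if "0 \<le> s" "hausdorff_measure s (basin - G0) = 0" for s
  proof (rule ccontr)
    assume "\<not> 1 < s"
    define \<gamma> where "\<gamma> t = \<rho> (of_real \<delta> * exp (of_real t * l))" for t :: real
    have in_ball: "of_real \<delta> * exp (of_real t * l) \<in> ball 0 \<delta>" if "t > 0" for t
      using that Re_l \<delta> by (simp add: norm_mult mult_pos_neg)
    have "connected (\<gamma> ` {0<..})"
    proof (rule connected_continuous_image)
      show "continuous_on {0<..} \<gamma>"
        unfolding \<gamma>_def using in_ball
        by (intro continuous_on_compose2[OF holomorphic_on_imp_continuous_on[OF \<rho>_holomorphic]]
            continuous_intros) auto
    qed simp
    moreover have "\<gamma> 1 \<noteq> \<gamma> 2"
    proof
      assume "\<gamma> 1 = \<gamma> 2"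
      then have "of_real \<delta> * exp (of_real 1 * l) = of_real \<delta> * exp (of_real 2 * l)"
        unfolding \<gamma>_def by (rule inj_onD[OF \<rho>_inj _ in_ball in_ball]) simp_all
      then have "\<delta> * exp (1 * Re l) = \<delta> * exp (2 * Re l)"
        using norm_spiral_point[OF \<delta>] by metis
      then show False using \<delta> Re_l by simp
    qed
    ultimately have "hausdorff_measure s (\<gamma> ` {0<..}) \<noteq> 0"
      using \<open>\<not> 1 < s\<close> that by (intro hausdorff_measure_connected_nonzero[of _ "\<gamma> 1" "\<gamma> 2"]) auto
    moreover have "\<gamma> ` {0<..} \<subseteq> basin - G0"
    proof clarify
      fix t :: real assume "t > 0"
      have U: "\<gamma> t \<in> U" unfolding \<gamma>_def using in_ball[OF \<open>t > 0\<close>] by (rule \<rho>_in_U)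
      have "\<Phi> (\<gamma> t) = of_real \<delta> * exp (of_real t * l)"
        unfolding \<Phi>_eq_\<phi>[OF U] unfolding \<gamma>_def using in_ball[OF \<open>t > 0\<close>] by (rule \<phi>_\<rho>)
      then have "\<Phi> (\<gamma> t) \<in> spiral" by (auto simp: log_spiral_def)
      then show "\<gamma> t \<in> basin - G0" using U U_subset_basin by (auto simp: G0_eq)
    qed
    ultimately show False using hausdorff_null_subset[OF that(2)] by blast
  qed
  let ?D = "{ennreal s |s. 0 \<le> s \<and> hausdorff_measure s (basin - G0) = 0}"
  have "1 \<le> Inf ?D"
  proof (rule Inf_greatest)
    fix x assume "x \<in> ?D"
    then obtain s where "x = ennreal s" "1 < s" using not_null by blast
    then show "1 \<le> x" by (simp add: ennreal_ge_1)
  qed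
  moreover have "Inf ?D \<le> 1"
  proof (rule ennreal_le_epsilon)
    fix e :: real assume "0 < e"
    then have "Inf ?D \<le> ennreal (1 + e)"
      using null[of "1 + e"] by (intro Inf_lower CollectI exI[of _ "1 + e"]) auto
    then show "Inf ?D \<le> 1 + ennreal e"
      using \<open>0 < e\<close> by (simp add: ennreal_plus)
  qed
  ultimately show ?thesis
    unfolding hausdorff_dim_def by (rule antisym[rotated])
qed

section \<open>Limit functions of locally universal functions\<close>

text \<open>Of two consecutive points \<open>\<rho>(\<lambda>\<^sup>nw)\<close> at least one is not the exceptional value of \<open>f\<close> and hence has
  an \<open>n\<close>-th preimage, at which \<open>\<Phi>\<close> takes the value \<open>w\<close>.\<close>

lemma \<Phi>_image_G0: "\<Phi> ` G0 = - spiral"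
proof
  show "\<Phi> ` G0 \<subseteq> - spiral" by (auto simp: G0_eq)
  show "- spiral \<subseteq> \<Phi> ` G0"
  proof
    fix w assume w: "w \<in> - spiral"
    then have "w \<noteq> 0" using zero_in_spiral by auto
    obtain e E where E: "E \<subseteq> {e :: complex}" "\<And>v. v \<notin> E \<Longrightarrow> \<exists>z. z \<notin> E \<and> f z = v"
      using entire_backward_step[OF entire nonconstant] by metis
    have "\<forall>\<^sub>F n in sequentially. lam ^ n * w \<in> ball 0 \<delta>"
      using lam_power_tendsto_0 \<delta> by (intro topological_tendstoD) auto
    then obtain n where n: "lam ^ n * w \<in> ball 0 \<delta>"
      using eventually_happens'[OF sequentially_bot] by blast
    have n': "lam ^ Suc n * w \<in> ball 0 \<delta>"
      using lam_power_in_ball[OF n, of 1] by (simp add: mult.assoc)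
    have "lam ^ n * w \<noteq> lam ^ Suc n * w"
      using lam \<open>w \<noteq> 0\<close> by auto
    then have "\<rho> (lam ^ n * w) \<noteq> \<rho> (lam ^ Suc n * w)"
      using inj_onD[OF \<rho>_inj _ n n'] by blast
    then have "\<rho> (lam ^ n * w) \<notin> E \<or> \<rho> (lam ^ Suc n * w) \<notin> E"
      using E(1) by auto
    then obtain m where m: "lam ^ m * w \<in> ball 0 \<delta>" "\<rho> (lam ^ m * w) \<notin> E"
      using n n' by blast
    then obtain z where z: "(f ^^ m) z = \<rho> (lam ^ m * w)"
      using iterate_preimage[OF E(2) m(2)] by blast
    then have zU: "(f ^^ m) z \<in> U" using \<rho>_in_U[OF m(1)] by simp
    have "\<rho> (lam ^ m * \<Phi> z) = \<rho> (lam ^ m * w)"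
      using iterate_eq_\<rho>(1)[OF zU] z by simp
    then have "\<Phi> z = w"
      using inj_onD[OF \<rho>_inj _ iterate_eq_\<rho>(2)[OF zU] m(1)] lam by simp
    moreover have "z \<in> basin" using zU basin_iff by blast
    ultimately show "w \<in> \<Phi> ` G0" using w by (auto simp: G0_eq)
  qed
qed

text \<open>For \<open>z\<close> near a given point of \<open>G\<^sub>0\<close> and large \<open>k\<close>, \<open>g(f\<^sup>k(z))\<close> is the value at \<open>\<Phi>(z)\<close> of the
  holomorphic function \<open>w \<mapsto> g(\<rho>(\<lambda>\<^sup>kw))\<close>; as \<open>\<Phi>\<close> is open, these functions converge uniformly on
  open sets.\<close>

lemma omega_limit_subset_H_Phi:
  assumes g: "g holomorphic_on basin - {z0}"
  shows "omega_limit G0 g f \<subseteq> H_Phi \<Phi> G0"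
proof
  fix h assume "h \<in> omega_limit G0 g f"
  then obtain r :: "nat \<Rightarrow> nat" where h: "h \<in> extensional G0" and r: "strict_mono r"
    and lim: "loc_uniform_limit G0 (\<lambda>k. g \<circ> (f ^^ r k)) h"
    unfolding omega_limit_def by blast
  have ev_r: "\<forall>\<^sub>F k in sequentially. n \<le> r k" for n
    using filterlim_subseq[OF r] by (simp add: filterlim_at_top)
  have orbit: "(f ^^ r k) z = \<rho> (lam ^ r k * \<Phi> z)" if "(f ^^ n) z \<in> U" "n \<le> r k" for n k z
    using iterate_eq_\<rho>(1)[OF iterate_in_U_mono[OF that]] .
  have pointwise: "(\<lambda>k. g (\<rho> (lam ^ r k * \<Phi> z))) \<longlonglongrightarrow> h z" if z: "z \<in> G0" for z
  proof -
    obtain N where N: "z \<in> N" "uniform_limit (N \<inter> G0) (\<lambda>k. g \<circ> (f ^^ r k)) h sequentially"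
      using lim z unfolding loc_uniform_limit_def by blast
    then have "(\<lambda>k. (g \<circ> (f ^^ r k)) z) \<longlonglongrightarrow> h z"
      using z by (intro tendsto_uniform_limitI[OF N(2)]) auto
    moreover have "\<forall>\<^sub>F k in sequentially. (g \<circ> (f ^^ r k)) z = g (\<rho> (lam ^ r k * \<Phi> z))"
    proof -
      obtain n where n: "(f ^^ n) z \<in> U" using z G0_subset_basin basin_iff by blast
      from ev_r[of n] show ?thesis
        by eventually_elim (simp add: orbit[OF n])
    qed
    ultimately show ?thesis by (rule Lim_transform_eventually)
  qed
  \<comment> \<open>The choice of the preimage does not matter: orbits of points with the same value of \<open>\<Phi>\<close> merge.\<close>
  define \<psi> where "\<psi> w = h (inv_into G0 \<Phi> w)" for w
  have \<psi>: "\<psi> (\<Phi> z) = h z" if z: "z \<in> G0" for z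
  proof -
    have "inv_into G0 \<Phi> (\<Phi> z) \<in> G0" "\<Phi> (inv_into G0 \<Phi> (\<Phi> z)) = \<Phi> z"
      using z by (auto intro: inv_into_into f_inv_into_f)
    then show ?thesis
      unfolding \<psi>_def using pointwise[OF z] pointwise[of "inv_into G0 \<Phi> (\<Phi> z)"]
      by (metis LIMSEQ_unique)
  qed
  have "\<psi> field_differentiable at w" if w: "w \<in> \<Phi> ` G0" for w
  proof -
    obtain z where z: "z \<in> G0" "w = \<Phi> z" using w by blast
    obtain N where N: "open N" "z \<in> N" "uniform_limit (N \<inter> G0) (\<lambda>k. g \<circ> (f ^^ r k)) h sequentially"
      using lim z unfolding loc_uniform_limit_def by blast
    obtain n where n: "(f ^^ n) z \<in> U" using z G0_subset_basin basin_iff by blast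
    define X where "X = N \<inter> G0 \<inter> (f ^^ n) -` U"
    have X: "open X" "X \<subseteq> basin" "z \<in> X" "X \<subseteq> N \<inter> G0"
      using N z n open_G0 open_vimage_iterate[OF U(1)] G0_subset_basin by (auto simp: X_def)
    have "\<psi> holomorphic_on \<Phi> ` X"
    proof (rule uniform_limit_imp_holomorphic)
      show "open (\<Phi> ` X)" by (rule open_image_\<Phi>[OF X(1,2)])
      show "uniform_limit (\<Phi> ` X) (\<lambda>k w. g (\<rho> (lam ^ r k * w))) \<psi> sequentially"
      proof (rule uniform_limitI)
        fix e :: real assume "0 < e"
        then have "\<forall>\<^sub>F k in sequentially. \<forall>x\<in>N \<inter> G0. dist ((g \<circ> (f ^^ r k)) x) (h x) < e"
          using N(3) by (rule uniform_limitD[rotated])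
        then show "\<forall>\<^sub>F k in sequentially. \<forall>v\<in>\<Phi> ` X. dist (g (\<rho> (lam ^ r k * v))) (\<psi> v) < e"
          using ev_r[of n]
        proof eventually_elim
          case (elim k)
          have "dist (g (\<rho> (lam ^ r k * \<Phi> x))) (\<psi> (\<Phi> x)) < e" if x: "x \<in> X" for x
          proof -
            have "(f ^^ r k) x = \<rho> (lam ^ r k * \<Phi> x)"
              using x elim(2) by (intro orbit) (auto simp: X_def)
            moreover have "\<psi> (\<Phi> x) = h x" using x by (intro \<psi>) (auto simp: X_def)
            moreover have "dist ((g \<circ> (f ^^ r k)) x) (h x) < e" using elim(1) x X by blast
            ultimately show ?thesis by simp
          qed
          then show ?case by blast
        qed
      qed
      show "\<forall>\<^sub>F k in sequentially. (\<lambda>w. g (\<rho> (lam ^ r k * w))) holomorphic_on \<Phi> ` X"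
        using ev_r[of n]
      proof eventually_elim
        case (elim k)
        have in_ball: "lam ^ r k * \<Phi> x \<in> ball 0 \<delta>" if "x \<in> X" for x
          using iterate_eq_\<rho>(2)[OF iterate_in_U_mono[OF _ elim], of x] that by (auto simp: X_def)
        have 1: "(\<lambda>w. \<rho> (lam ^ r k * w)) holomorphic_on \<Phi> ` X"
          using in_ball
          by (intro holomorphic_on_compose_gen[OF _ \<rho>_holomorphic, unfolded o_def] holomorphic_intros)
            auto
        have "\<rho> (lam ^ r k * \<Phi> x) \<in> basin - {z0}" if x: "x \<in> X" for x
        proof -
          have "lam ^ r k * \<Phi> x \<noteq> 0"
            using x X lam zero_in_spiral by (auto simp: G0_eq)
          then have "\<rho> (lam ^ r k * \<Phi> x) \<noteq> z0"
            using \<phi>_\<rho>[OF in_ball[OF x]] \<phi>_z0 by auto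
          then show ?thesis
            using \<rho>_in_U[OF in_ball[OF x]] U_subset_basin by auto
        qed
        then show ?case
          by (intro holomorphic_on_compose_gen[OF 1 g, unfolded o_def]) auto
      qed
    qed
    then show ?thesis
      using open_image_\<Phi>[OF X(1,2)] X(3) z(2) holomorphic_on_imp_differentiable_at by blast
  qed
  then have "\<psi> holomorphic_on \<Phi> ` G0"
    by (simp add: holomorphic_on_def field_differentiable_at_within)
  then have "restrict \<psi> (\<Phi> ` G0) \<in> hol (\<Phi> ` G0)"
    unfolding hol_def by (auto intro: holomorphic_transform)
  moreover have "h = restrict (restrict \<psi> (\<Phi> ` G0) \<circ> \<Phi>) G0"
    using h by (intro extensionalityI[of _ G0]) (auto simp: \<psi>)
  ultimately show "h \<in> H_Phi \<Phi> G0"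
    unfolding H_Phi_def by blast
qed

text \<open>Multiplication by a high power \<open>\<lambda>\<^sup>m\<close> moves a compact set \<open>K\<close> off the spiral into a small disc
  minus the spiral, whose image \<open>W\<close> under \<open>\<rho>\<close> has no holes. Universality on \<open>W\<close> then yields
  \<open>g \<circ> f\<^sup>n\<close> close to the function on \<open>W\<close> that takes the value \<open>\<psi>(w)\<close> at \<open>\<rho>(\<lambda>\<^sup>mw)\<close>. Since \<open>m\<close> may be
  taken as large as desired, so may the exponent \<open>n + m\<close>.\<close>

lemma locally_universal_approximation:
  assumes g: "locally_universal f z0 lam g"
    and \<psi>: "\<psi> holomorphic_on - spiral" and K: "compact K" "K \<subseteq> - spiral" and e: "0 < e"
  shows "\<exists>r>N. \<forall>w\<in>K. dist (g (\<rho> (lam ^ r * w))) (\<psi> w) < e"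
proof -
  obtain U' where U': "open U'" "z0 \<in> U'"
    and dense: "\<And>W. W \<in> U0_sets (U' - {z0}) \<Longrightarrow> dense_in_hol W {restrict (g \<circ> (f ^^ n)) W | n. 1 \<le> n}"
    using g unfolding locally_universal_def by blast
  have "open (ball 0 \<delta> \<inter> \<rho> -` U')"
    by (intro continuous_open_preimage holomorphic_on_imp_continuous_on \<rho>_holomorphic U') auto
  moreover have "0 \<in> ball 0 \<delta> \<inter> \<rho> -` U'"
    using \<delta> \<rho>_0 U' by simp
  ultimately obtain \<eta> where \<eta>: "0 < \<eta>" "ball 0 \<eta> \<subseteq> ball 0 \<delta> \<inter> \<rho> -` U'"
    by (meson openE)
  define B where "B = ball 0 \<eta> - spiral"
  define W where "W = \<rho> ` B"
  have B: "open B" "B \<subseteq> ball 0 \<delta>" "simply_connected B" "B \<noteq> {}"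
    using closed_spiral \<eta> simply_connected_ball_minus_log_spiral[OF \<delta> Re_l \<eta>(1)]
      log_spiral_avoided_by_open[OF \<delta> Re_l, of "ball 0 \<eta>"]
    by (auto simp: B_def open_Diff)
  have \<rho>_B: "\<rho> holomorphic_on B" "inj_on \<rho> B"
    using B \<rho>_holomorphic \<rho>_inj holomorphic_on_subset inj_on_subset by blast+
  have "open W"
    unfolding W_def by (intro open_mapping_thm3 \<rho>_B B)
  moreover have "simply_connected W"
    unfolding W_def by (intro simply_connected_injective_holomorphic_image \<rho>_B B)
  moreover have "W \<subseteq> U' - {z0}"
  proof
    fix z assume "z \<in> W"
    then obtain w where w: "w \<in> B" "z = \<rho> w" by (auto simp: W_def)
    then have "w \<noteq> 0" using zero_in_spiral by (auto simp: B_def)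
    then have "z \<noteq> z0" using w B \<phi>_\<rho>[of w] \<phi>_z0 by auto
    then show "z \<in> U' - {z0}" using w \<eta>(2) by (auto simp: B_def)
  qed
  ultimately have W: "W \<in> U0_sets (U' - {z0})"
    using B simply_connected_imp_no_holes by (auto simp: U0_sets_def W_def)
  obtain b where b: "\<And>w. w \<in> K \<Longrightarrow> norm w \<le> b" "0 < b"
    using compact_imp_bounded[OF K(1)] bounded_pos by metis
  have "\<forall>\<^sub>F n in sequentially. lam ^ n * of_real b \<in> ball 0 \<eta>"
    using lam_power_tendsto_0 \<eta> by (intro topological_tendstoD) auto
  then have "\<forall>\<^sub>F n in sequentially. lam ^ n * of_real b \<in> ball 0 \<eta> \<and> N \<le> n"
    using eventually_ge_at_top[of N] by eventually_elim auto
  then obtain m where m: "lam ^ m * of_real b \<in> ball 0 \<eta>" "N \<le> m"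
    using eventually_happens'[OF sequentially_bot] by blast
  have K_B: "lam ^ m * w \<in> B" if "w \<in> K" for w
  proof -
    have "norm (lam ^ m * w) \<le> norm (lam ^ m * of_real b)"
      using b(1)[OF that] b(2) by (auto simp: norm_mult intro: mult_left_mono)
    then show ?thesis
      using m(1) K that by (auto simp: B_def lam_power_spiral)
  qed
  define K' where "K' = \<rho> ` ((\<lambda>w. lam ^ m * w) ` K)"
  have "compact K'"
    unfolding K'_def
  proof (rule compact_continuous_image)
    show "continuous_on ((\<lambda>w. lam ^ m * w) ` K) \<rho>"
      using K_B by (intro continuous_on_subset[OF holomorphic_on_imp_continuous_on[OF \<rho>_B(1)]]) auto
  qed (intro compact_continuous_image K continuous_intros)
  moreover have "K' \<subseteq> W"
    using K_B by (auto simp: K'_def W_def)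
  moreover define h where "h = restrict (\<lambda>z. \<psi> (\<phi> z / lam ^ m)) W"
  have W_U: "W \<subseteq> U" using B \<rho>_in_U by (auto simp: W_def)
  have "h \<in> hol W"
  proof -
    have "\<phi> z / lam ^ m \<notin> spiral" if "z \<in> W" for z
    proof -
      have "\<phi> z \<in> B" using that B \<phi>_\<rho> by (auto simp: W_def)
      moreover have "\<phi> z = lam ^ m * (\<phi> z / lam ^ m)" using lam by simp
      ultimately show ?thesis using lam_power_spiral[of m "\<phi> z / lam ^ m"] by (auto simp: B_def)
    qed
    then have "(\<lambda>z. \<psi> (\<phi> z / lam ^ m)) holomorphic_on W"
      using lam holomorphic_on_subset[OF \<phi>_holomorphic W_U]
      by (intro holomorphic_on_compose_gen[OF _ \<psi>, unfolded o_def] holomorphic_intros) auto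
    then show ?thesis
      unfolding hol_def h_def by (auto intro: holomorphic_transform)
  qed
  ultimately have "\<exists>k\<in>{restrict (g \<circ> (f ^^ n)) W | n. 1 \<le> n}. \<forall>z\<in>K'. dist (k z) (h z) < e"
    using dense[OF W] e unfolding dense_in_hol_iff by blast
  then obtain n where n: "1 \<le> n" "\<And>z. z \<in> K' \<Longrightarrow> dist (restrict (g \<circ> (f ^^ n)) W z) (h z) < e"
    by blast
  have "dist (g (\<rho> (lam ^ (n + m) * w))) (\<psi> w) < e" if w: "w \<in> K" for w
  proof -
    have wB: "lam ^ m * w \<in> B" by (rule K_B[OF w])
    then have ball: "lam ^ m * w \<in> ball 0 \<delta>" using B by blast
    have "\<rho> (lam ^ m * w) \<in> K'" "\<rho> (lam ^ m * w) \<in> W" using w wB by (auto simp: K'_def W_def)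
    moreover have "h (\<rho> (lam ^ m * w)) = \<psi> w"
      using \<open>\<rho> (lam ^ m * w) \<in> W\<close> \<phi>_\<rho>[OF ball] lam by (simp add: h_def)
    moreover have "(f ^^ n) (\<rho> (lam ^ m * w)) = \<rho> (lam ^ (n + m) * w)"
      using iterate_\<rho>[OF ball] by (simp add: power_add mult.assoc)
    ultimately show ?thesis
      using n(2)[of "\<rho> (lam ^ m * w)"] by simp
  qed
  then show ?thesis
    using n(1) m(2) by (intro exI[of _ "n + m"]) auto
qed

text \<open>Exhausting the complement of the spiral by compact sets and approximating better and better on
  them gives one sequence of iterates that works on every compact set.\<close>

lemma H_Phi_subset_omega_limit:
  assumes g: "locally_universal f z0 lam g"
  shows "H_Phi \<Phi> G0 \<subseteq> omega_limit G0 g f"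
proof
  fix h assume "h \<in> H_Phi \<Phi> G0"
  then obtain \<psi> where h: "h = restrict (\<psi> \<circ> \<Phi>) G0" and \<psi>: "\<psi> holomorphic_on - spiral"
    unfolding H_Phi_def hol_def \<Phi>_image_G0 by blast
  let ?E = "\<lambda>C :: nat \<Rightarrow> complex set. (\<forall>n. compact (C n)) \<and> (\<forall>n. C n \<subseteq> - spiral) \<and>
      (\<forall>K. compact K \<and> K \<subseteq> - spiral \<longrightarrow> (\<exists>N. \<forall>n\<ge>N. K \<subseteq> C n))"
  have "\<exists>C. ?E C"
  proof (rule open_Union_compact_subsets[OF open_Compl[OF closed_spiral]])
    fix C :: "nat \<Rightarrow> complex set"
    assume "\<And>n. compact (C n)" "\<And>n. C n \<subseteq> - spiral"
      "\<And>K. compact K \<Longrightarrow> K \<subseteq> - spiral \<Longrightarrow> \<exists>N. \<forall>n\<ge>N. K \<subseteq> C n"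
    then show ?thesis by (intro exI[of _ C]) simp
  qed
  then obtain C where "?E C" ..
  then have C: "compact (C n)" "C n \<subseteq> - spiral"
    and exhaust: "compact K \<Longrightarrow> K \<subseteq> - spiral \<Longrightarrow> \<exists>N. \<forall>n\<ge>N. K \<subseteq> C n" for n K
    by simp_all
  let ?P = "\<lambda>k r. 1 \<le> r \<and> (\<forall>w\<in>C k. dist (g (\<rho> (lam ^ r * w))) (\<psi> w) < 1 / real (Suc k))"
  have approx: "\<exists>r. ?P k r \<and> r > N" for k N
  proof -
    have "0 < 1 / real (Suc k)" by simp
    then obtain m where m: "N < m" "\<forall>w\<in>C k. dist (g (\<rho> (lam ^ m * w))) (\<psi> w) < 1 / real (Suc k)"
      using locally_universal_approximation[OF g \<psi> C(1,2)] by blast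
    moreover have "1 \<le> m" using m(1) by linarith
    ultimately show ?thesis by blast
  qed
  obtain r where r: "\<And>k. ?P k (r k)" "\<And>k. r k < r (Suc k)"
    using dependent_nat_choice[of ?P "\<lambda>k x y. x < y"] approx by metis
  have mono: "strict_mono r" using r(2) by (simp add: strict_mono_Suc_iff)
  have "loc_uniform_limit G0 (\<lambda>k. g \<circ> (f ^^ r k)) h"
    unfolding loc_uniform_limit_def
  proof
    fix z assume z: "z \<in> G0"
    obtain n where n: "(f ^^ n) z \<in> U" using z G0_subset_basin basin_iff by blast
    have "open (G0 \<inter> (f ^^ n) -` U)" using open_G0 open_vimage_iterate[OF U(1)] by auto
    then obtain d where d: "0 < d" "cball z d \<subseteq> G0 \<inter> (f ^^ n) -` U"
      using z n by (metis IntI open_contains_cball vimageI2)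
    have "compact (\<Phi> ` cball z d)"
      using d G0_subset_basin
      by (intro compact_continuous_image continuous_on_subset[OF holomorphic_on_imp_continuous_on[OF \<Phi>_holomorphic]])
        auto
    moreover have "\<Phi> ` cball z d \<subseteq> - spiral" using d \<Phi>_image_G0 by blast
    ultimately obtain M where M: "\<And>k. k \<ge> M \<Longrightarrow> \<Phi> ` cball z d \<subseteq> C k"
      using exhaust by blast
    have "uniform_limit (ball z d \<inter> G0) (\<lambda>k. g \<circ> (f ^^ r k)) h sequentially"
    proof (rule uniform_limitI)
      fix e :: real assume "0 < e"
      have "\<forall>\<^sub>F k in sequentially. 1 / real (Suc k) < e"
        using order_tendstoD(2)[OF LIMSEQ_Suc[OF lim_1_over_n] \<open>0 < e\<close>] .
      moreover have "\<forall>\<^sub>F k in sequentially. n \<le> r k"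
        using filterlim_subseq[OF mono] by (simp add: filterlim_at_top)
      ultimately show "\<forall>\<^sub>F k in sequentially. \<forall>x\<in>ball z d \<inter> G0. dist ((g \<circ> (f ^^ r k)) x) (h x) < e"
        using eventually_ge_at_top[of M]
      proof eventually_elim
        case (elim k)
        have "dist ((g \<circ> (f ^^ r k)) x) (h x) < e" if x: "x \<in> ball z d \<inter> G0" for x
        proof -
          have "(f ^^ n) x \<in> U" using x d(2) ball_subset_cball by blast
          then have "(f ^^ r k) x = \<rho> (lam ^ r k * \<Phi> x)"
            using iterate_eq_\<rho>(1)[OF iterate_in_U_mono] elim(2) by blast
          moreover have "\<Phi> x \<in> C k" using M[OF elim(3)] x by auto
          then have "dist (g (\<rho> (lam ^ r k * \<Phi> x))) (\<psi> (\<Phi> x)) < 1 / real (Suc k)"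
            using r(1) by blast
          ultimately show ?thesis using elim(1) x h by simp
        qed
        then show ?case by blast
      qed
    qed
    then show "\<exists>N. open N \<and> z \<in> N \<and> uniform_limit (N \<inter> G0) (\<lambda>k. g \<circ> (f ^^ r k)) h sequentially"
      using d(1) by (intro exI[of _ "ball z d"]) auto
  qed
  then show "h \<in> omega_limit G0 g f"
    unfolding omega_limit_def using mono r(1) h by auto
qed

end

theorem theorem4p7:
  fixes f \<phi> \<Phi> :: "complex \<Rightarrow> complex" and z0 lam l :: complex
    and U :: "complex set" and \<delta> :: real
  assumes f_entire: "f holomorphic_on UNIV"
    and f_not_linear: "\<not> (\<exists>p :: complex poly. degree p \<le> 1 \<and> f = poly p)"
    and fixed_point: "f z0 = z0"
    and multiplier: "lam = deriv f z0"
    and attracting: "0 < norm lam" "norm lam < 1"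
    and U: "open U" "z0 \<in> U" "f ` U \<subseteq> U"
    and \<delta>: "0 < \<delta>"
    and V_invariant: "(\<lambda>w. lam * w) ` ball 0 \<delta> \<subseteq> ball 0 \<delta>"
    and \<phi>_conformal: "conformal_map \<phi> U (ball 0 \<delta>)"
    and \<phi>_eq: "\<And>n z. 1 \<le> n \<Longrightarrow> z \<in> U \<Longrightarrow> \<phi> ((f ^^ n) z) = lam ^ n * \<phi> z"
    and \<Phi>_holomorphic: "\<Phi> holomorphic_on attraction_basin f z0"
    and \<Phi>_extends: "\<And>z. z \<in> U \<Longrightarrow> \<Phi> z = \<phi> z"
    and \<Phi>_eq: "\<And>n z. 1 \<le> n \<Longrightarrow> z \<in> attraction_basin f z0 \<Longrightarrow> \<Phi> ((f ^^ n) z) = lam ^ n * \<Phi> z"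
    and log_lam: "exp l = lam"
  shows "open (G0_set f U \<phi> \<delta> l)
    \<and> G0_set f U \<phi> \<delta> l \<subseteq> attraction_basin f z0 - backward_orbit f z0
    \<and> attraction_basin f z0 - backward_orbit f z0 \<subseteq> closure (G0_set f U \<phi> \<delta> l)
    \<and> hausdorff_dim (attraction_basin f z0 - G0_set f U \<phi> \<delta> l) = 1
    \<and> (\<forall>g. locally_universal f z0 lam g \<longrightarrow>
          omega_limit (G0_set f U \<phi> \<delta> l) g f = H_Phi \<Phi> (G0_set f U \<phi> \<delta> l))"
proof -
  interpret koenigs_chart f \<phi> \<Phi> z0 lam l U \<delta>
  proof
    show "\<not> f constant_on UNIV"
    proof
      assume "f constant_on UNIV"
      then obtain c where "\<And>z. f z = c" by (auto simp: constant_on_def)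
      then have "f = poly [:c:]" by auto
      then show False using f_not_linear by (metis degree_pCons_0 zero_le_one)
    qed
    show "\<phi> (f z) = lam * \<phi> z" if "z \<in> U" for z
      using \<phi>_eq[of 1 z] that by simp
    show "\<Phi> ((f ^^ n) z) = lam ^ n * \<Phi> z" if "z \<in> attraction_basin f z0" for n z
      using \<Phi>_eq[of n z] that by (cases "n = 0") auto
  qed (use assms in auto)
  have "omega_limit G0 g f = H_Phi \<Phi> G0" if "locally_universal f z0 lam g" for g
    using that omega_limit_subset_H_Phi[of g] H_Phi_subset_omega_limit[of g]
    by (auto simp: locally_universal_def)
  then show ?thesis
    using open_G0 G0_subset_basin G0_disjoint_backward_orbit basin_subset_closure_G0
      hausdorff_dim_basin_minus_G0
    by blast
qed

end
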